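(* Let $\alpha_F\ge\frac12+C_{dt}(k_z)$ for all $F\in\mathcal F^{vi}$. Then for every $f\in L^2(\Omega)$ and $g\in L^2(\Gamma;\mu)$ there exists a unique $u_h\in V_h$ such that $$a_h(u_h,v_h)=(f,v_h)+\langle g,v_h\rangle\quad\text{for all }v_h\in V_h.$$
   Context: $L>0$, $\Omega=(0,L)\times(0,1)$ with coordinates $(z,\mu)$, $\Gamma=\{0,L\}\times(0,1)$; $L^2(\Gamma;\mu)$ is the space of measurable $g$ on $\Gamma$ with $\langle g,g\rangle<\infty$, where $\langle u,v\rangle=\int_0^1(u(L,\mu)v(L,\mu)+u(0,\mu)v(0,\mu))\mu\,d\mu$; $(\cdot,\cdot)$ is the $L^2(\Omega)$ inner product. $V=\{v\in L^2(\Omega):\mu\partial_z v\in L^2(\Omega)\}$. Coefficients $\sigma_s,\sigma_t\in L^\infty(0,L)$ depend on $z$ only, with $\sigma_s\ge0$ and $\sigma_t-\sigma_s\ge c>0$. $(Pu)(z,\mu)=\int_0^1u(z,\mu')d\mu'$. $\mathcal T$ is a finite partition of $\Omega$ into open rectangles $K=(z_K^l,z_K^r)\times(\mu_K^l,\mu_K^r)$ (hanging nodes allowed) with $\sigma_t$ constant on each $K$; $h_K=z_K^r-z_K^l$. For integers $k_z,k_\mu\ge0$, $V_h=\{v\in L^2(\Omega):v|_K\in\mathbb P_{k_z+1}\otimes\mathbb P_{k_\mu}\ \forall K\}$; $\partial_z^h$ is the broken $z$-derivative. Interior vertical faces $F\in\mathcal F^{vi}$: $F=\{z_F\}\times(\mu_F^b,\mu_F^t)$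 where two distinct elements $K_1,K_2$ satisfy $z_F=z_1^r=z_2^l$ and $(\mu_F^b,\mu_F^t)=(\mu_1^l,\mu_1^r)\cap(\mu_2^l,\mu_2^r)\ne\emptyset$. Jump $[\![v]\!]=v|_{K_1}(z_F,\cdot)-v|_{K_2}(z_F,\cdot)$, average $\{\!\{v\}\!\}=\frac12(v|_{K_1}(z_F,\cdot)+v|_{K_2}(z_F,\cdot))$; $D_{F,\sigma}=\big(\frac{1}{\sigma_t|_{K_1}h_{K_1}}+\frac{1}{\sigma_t|_{K_2}h_{K_2}}\big)^{-1}$. $C_{dt}(k)=1+2\sqrt{C_{ie}(k)}$ with $C_{ie}(k)$ the scale-invariant inverse-inequality constant $\|p'\|_{L^2(I)}\le\frac{\sqrt{C_{ie}(k)}}{|I|}\|p\|_{L^2(I)}$ for all intervals $I$ and polynomials $p$ of degree $\le k$. Bilinear forms: $a_h^e(u,v)=(\sigma_t^{-1}\mu\partial_z^hu,\mu\partial_z^hv)+(\sigma_tu,v)-(\sigma_sPu,v)+\langle u,v\rangle$ and $a_h(u,v)=a_h^e(u,v)-\sum_{F\in\mathcal F^{vi}}\int_F\big(\{\!\{\tfrac{\mu}{\sigma_t}\partial_z^hu\}\!\}[\![v]\!]+\{\!\{\tfrac{\mu}{\sigma_t}\partial_z^hv\}\!\}[\![u]\!]\big)\mu\,d\mu+\sum_{F\in\mathcal F^{vi}}\frac{\alpha_F}{D_{F,\sigma}}\int_F[\![u]\!][\![v]\!]\mu\,d\mu$ with penalty parameters $\alpha_F>0$. *)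

theory Defs
  imports "HOL-Analysis.Analysis" "HOL-Computational_Algebra.Polynomial"
begin

definition Omega :: "real \<Rightarrow> (real \<times> real) set" where
  "Omega L = {0<..<L} \<times> {0<..<(1::real)}"

definition L2 :: "(real \<times> real) set \<Rightarrow> (real \<times> real \<Rightarrow> real) \<Rightarrow> bool" where
  "L2 S f \<longleftrightarrow> f \<in> borel_measurable (lebesgue_on S) \<and>
     integrable (lebesgue_on S) (\<lambda>x. (f x)^2)"

definition L2_Gamma :: "real \<Rightarrow> (real \<times> real \<Rightarrow> real) \<Rightarrow> bool" where
  "L2_Gamma L g \<longleftrightarrow>
     (\<lambda>\<mu>. g (L,\<mu>)) \<in> borel_measurable (lebesgue_on {0<..<(1::real)}) \<and>
     (\<lambda>\<mu>. g (0,\<mu>)) \<in> borel_measurable (lebesgue_on {0<..<(1::real)}) \<and>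
     integrable (lebesgue_on {0<..<(1::real)}) (\<lambda>\<mu>. ((g (L,\<mu>))^2 + (g (0,\<mu>))^2) * \<mu>)"

definition ip :: "real \<Rightarrow> (real \<times> real \<Rightarrow> real) \<Rightarrow> (real \<times> real \<Rightarrow> real) \<Rightarrow> real" where
  "ip L u v = (LINT x|lebesgue_on (Omega L). u x * v x)"

definition bip :: "real \<Rightarrow> (real \<times> real \<Rightarrow> real) \<Rightarrow> (real \<times> real \<Rightarrow> real) \<Rightarrow> real" where
  "bip L u v = (LINT \<mu>|lebesgue_on {0<..<(1::real)}.
       (u (L,\<mu>) * v (L,\<mu>) + u (0,\<mu>) * v (0,\<mu>)) * \<mu>)"

definition trace_h :: "real \<Rightarrow> (real \<times> real \<Rightarrow> real) \<Rightarrow> (real \<times> real \<Rightarrow> real)" where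
  "trace_h L v = (\<lambda>(z,\<mu>). if z = 0 then Lim (at_right 0) (\<lambda>t. v (t,\<mu>))
                     else if z = L then Lim (at_left L) (\<lambda>t. v (t,\<mu>)) else v (z,\<mu>))"

definition dzh :: "(real \<times> real \<Rightarrow> real) \<Rightarrow> (real \<times> real \<Rightarrow> real)" where
  "dzh u = (\<lambda>(z,\<mu>). deriv (\<lambda>t. u (t,\<mu>)) z)"

definition Pop :: "(real \<times> real \<Rightarrow> real) \<Rightarrow> (real \<times> real \<Rightarrow> real)" where
  "Pop u = (\<lambda>(z,\<mu>). LINT \<mu>'|lebesgue_on {0<..<(1::real)}. u (z,\<mu>'))"

type_synonym rect = "real \<times> real \<times> real \<times> real"

definition zl :: "rect \<Rightarrow> real" where "zl K = fst K"
definition zr :: "rect \<Rightarrow> real" where "zr K = fst (snd K)"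
definition ml :: "rect \<Rightarrow> real" where "ml K = fst (snd (snd K))"
definition mr :: "rect \<Rightarrow> real" where "mr K = snd (snd (snd K))"

definition rect_set :: "rect \<Rightarrow> (real \<times> real) set" where
  "rect_set K = {zl K<..<zr K} \<times> {ml K<..<mr K}"

definition hK :: "rect \<Rightarrow> real" where "hK K = zr K - zl K"

(* finite partition of Omega into open rectangles (hanging nodes allowed) *)
definition is_mesh :: "real \<Rightarrow> rect set \<Rightarrow> bool" where
  "is_mesh L T \<longleftrightarrow> finite T \<and>
     (\<forall>K\<in>T. zl K < zr K \<and> ml K < mr K \<and> rect_set K \<subseteq> Omega L) \<and>
     (\<forall>K\<in>T. \<forall>K'\<in>T. K \<noteq> K' \<longrightarrow> rect_set K \<inter> rect_set K' = {}) \<and>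
     Omega L \<subseteq> (\<Union>K\<in>T. closure (rect_set K))"

(* V_h: piecewise P_{kz+1} (x) P_{kmu}; canonical representative = 0 off the open elements *)
definition Vh :: "rect set \<Rightarrow> nat \<Rightarrow> nat \<Rightarrow> (real \<times> real \<Rightarrow> real) set" where
  "Vh T kz kmu = {v. (\<forall>K\<in>T. \<exists>c :: nat \<Rightarrow> nat \<Rightarrow> real. \<forall>z \<mu>. (z,\<mu>) \<in> rect_set K \<longrightarrow>
          v (z,\<mu>) = (\<Sum>i\<le>kz+1. \<Sum>j\<le>kmu. c i j * z^i * \<mu>^j)) \<and>
        (\<forall>x. x \<notin> (\<Union>K\<in>T. rect_set K) \<longrightarrow> v x = 0)}"

(* interior vertical faces, identified with the pair (K1,K2) *)
definition vfaces :: "rect set \<Rightarrow> (rect \<times> rect) set" where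
  "vfaces T = {(K1,K2). K1 \<in> T \<and> K2 \<in> T \<and> K1 \<noteq> K2 \<and> zr K1 = zl K2 \<and>
                 max (ml K1) (ml K2) < min (mr K1) (mr K2)}"

definition zF :: "rect \<times> rect \<Rightarrow> real" where "zF F = zr (fst F)"
definition mbF :: "rect \<times> rect \<Rightarrow> real" where "mbF F = max (ml (fst F)) (ml (snd F))"
definition mtF :: "rect \<times> rect \<Rightarrow> real" where "mtF F = min (mr (fst F)) (mr (snd F))"

(* value from K1 (left) and from K2 (right) at the face *)
definition jump :: "rect \<times> rect \<Rightarrow> (real \<times> real \<Rightarrow> real) \<Rightarrow> real \<Rightarrow> real" where
  "jump F w \<mu> = Lim (at_left (zF F)) (\<lambda>z. w (z,\<mu>)) - Lim (at_right (zF F)) (\<lambda>z. w (z,\<mu>))"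

definition avg :: "rect \<times> rect \<Rightarrow> (real \<times> real \<Rightarrow> real) \<Rightarrow> real \<Rightarrow> real" where
  "avg F w \<mu> = (Lim (at_left (zF F)) (\<lambda>z. w (z,\<mu>)) + Lim (at_right (zF F)) (\<lambda>z. w (z,\<mu>))) / 2"

definition face_int :: "rect \<times> rect \<Rightarrow> (real \<Rightarrow> real) \<Rightarrow> real" where
  "face_int F \<phi> = (LINT \<mu>|lebesgue_on {mbF F<..<mtF F}. \<phi> \<mu> * \<mu>)"

(* sigma_t restricted to K (sigma_t is constant on each element) *)
definition sigK :: "(real \<Rightarrow> real) \<Rightarrow> rect \<Rightarrow> real" where
  "sigK \<sigma>t K = \<sigma>t ((zl K + zr K) / 2)"

definition DF :: "(real \<Rightarrow> real) \<Rightarrow> rect \<times> rect \<Rightarrow> real" where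
  "DF \<sigma>t F = inverse (inverse (sigK \<sigma>t (fst F) * hK (fst F)) + inverse (sigK \<sigma>t (snd F) * hK (snd F)))"

definition flux :: "(real \<Rightarrow> real) \<Rightarrow> (real \<times> real \<Rightarrow> real) \<Rightarrow> (real \<times> real \<Rightarrow> real)" where
  "flux \<sigma>t u = (\<lambda>(z,\<mu>). \<mu> / \<sigma>t z * dzh u (z,\<mu>))"

definition a_he :: "real \<Rightarrow> (real \<Rightarrow> real) \<Rightarrow> (real \<Rightarrow> real) \<Rightarrow>
     (real \<times> real \<Rightarrow> real) \<Rightarrow> (real \<times> real \<Rightarrow> real) \<Rightarrow> real" where
  "a_he L \<sigma>s \<sigma>t u v =
     ip L (\<lambda>(z,\<mu>). inverse (\<sigma>t z) * (\<mu> * dzh u (z,\<mu>))) (\<lambda>(z,\<mu>). \<mu> * dzh v (z,\<mu>))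
   + ip L (\<lambda>(z,\<mu>). \<sigma>t z * u (z,\<mu>)) v
   - ip L (\<lambda>(z,\<mu>). \<sigma>s z * Pop u (z,\<mu>)) v
   + bip L (trace_h L u) (trace_h L v)"

definition a_h :: "real \<Rightarrow> (real \<Rightarrow> real) \<Rightarrow> (real \<Rightarrow> real) \<Rightarrow> rect set \<Rightarrow> (rect \<times> rect \<Rightarrow> real) \<Rightarrow>
     (real \<times> real \<Rightarrow> real) \<Rightarrow> (real \<times> real \<Rightarrow> real) \<Rightarrow> real" where
  "a_h L \<sigma>s \<sigma>t T \<alpha> u v =
     a_he L \<sigma>s \<sigma>t u v
   - (\<Sum>F\<in>vfaces T. face_int F (\<lambda>\<mu>. avg F (flux \<sigma>t u) \<mu> * jump F v \<mu>
                                     + avg F (flux \<sigma>t v) \<mu> * jump F u \<mu>))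
   + (\<Sum>F\<in>vfaces T. \<alpha> F / DF \<sigma>t F * face_int F (\<lambda>\<mu>. jump F u \<mu> * jump F v \<mu>))"

definition C_ie :: "nat \<Rightarrow> real" where
  "C_ie k = Inf {C. 0 \<le> C \<and> (\<forall>a b (p :: real poly). a < b \<and> degree p \<le> k \<longrightarrow>
      sqrt (integral {a..b} (\<lambda>x. (poly (pderiv p) x)^2))
        \<le> sqrt C / (b - a) * sqrt (integral {a..b} (\<lambda>x. (poly p x)^2)))}"

definition C_dt :: "nat \<Rightarrow> real" where
  "C_dt k = 1 + 2 * sqrt (C_ie k)"

end

theory Submission
  imports Defs
begin

text \<open>On the finite-dimensional space \<open>V\<^sub>h\<close> a linear problem with a definite bilinear form is uniquely
  solvable, so everything rests on \<open>a\<^sub>h(u,u) \<ge> c \<parallel>u\<parallel>\<^sup>2\<close>. By Jensen \<open>(\<sigma>\<^sub>s P u, u) \<le> (\<sigma>\<^sub>s u, u)\<close>, hence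
  absorption minus scattering is at least \<open>c \<parallel>u\<parallel>\<^sup>2\<close>. In the consistency term, Young's inequality splits
  each face contribution into a jump part, controlled by the penalty as soon as \<open>\<alpha> \<ge> C\<^sub>d\<^sub>t / 2\<close>, and the
  boundary value of \<open>\<mu> \<partial>\<^sub>z u\<close>, which is a polynomial of degree at most \<open>k\<^sub>z\<close> in \<open>z\<close>: by the discrete trace
  inequality it is controlled by half of the gradient energy on the strip of the element next to the
  face. For each element the strips belonging to its left faces are disjoint, and so are those
  belonging to its right faces, so the total never exceeds the gradient energy.\<close>

section \<open>Definite forms on finite-dimensional function spaces\<close>

text \<open>Three gaps separate the argument from the definitions. \<open>C_ie\<close> is an
  infimum, so it carries information only once some inverse constant is known to exist; one is
  obtained by representing coefficient functionals in L^2(0,1), through the same solvability lemma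
  that later yields the discrete solution. The form \<open>a_h\<close> is written with
  \<open>Lim\<close> and \<open>deriv\<close> of functions that vanish off the open elements;
  extending each piece and its z-derivative to the whole plane replaces these by explicit values,
  and disjointness of the elements decides which piece a one-sided limit on a face sees. Finally,
  \<sigma>s is only Lebesgue measurable and bounded almost everywhere, so it is replaced by a
  bounded Borel representative \<rho> before Fubini is applied. The trace inequality is used in z
  alone, for each fixed \<mu>; hence hanging nodes cost nothing, because a face merely selects a
  range of \<mu>.\<close>

definition lincombs :: "('i \<Rightarrow> 'x \<Rightarrow> real) \<Rightarrow> 'i set \<Rightarrow> ('x \<Rightarrow> real) set" where
  "lincombs \<phi> I = range (\<lambda>c x. \<Sum>i\<in>I. c i * \<phi> i x)"

lemma lincombs_lin:
  assumes "u \<in> lincombs \<phi> I" "v \<in> lincombs \<phi> I"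
  shows "(\<lambda>x. u x + s * v x) \<in> lincombs \<phi> I"
proof -
  obtain c d where "u = (\<lambda>x. \<Sum>i\<in>I. c i * \<phi> i x)" "v = (\<lambda>x. \<Sum>i\<in>I. d i * \<phi> i x)"
    using assms by (auto simp: lincombs_def)
  then have "(\<lambda>x. u x + s * v x) = (\<lambda>x. \<Sum>i\<in>I. (c i + s * d i) * \<phi> i x)"
    by (simp add: sum.distrib sum_distrib_left algebra_simps)
  then show ?thesis by (auto simp: lincombs_def)
qed

lemma lincombs_insert:
  assumes "finite I" "i \<notin> I"
  shows "lincombs \<phi> (insert i I) = {\<lambda>x. u x + t * \<phi> i x | u t. u \<in> lincombs \<phi> I}"
proof (intro equalityI subsetI)
  fix v assume "v \<in> lincombs \<phi> (insert i I)"
  then obtain c where "v = (\<lambda>x. \<Sum>j\<in>insert i I. c j * \<phi> j x)" by (auto simp: lincombs_def)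
  then have "v = (\<lambda>x. (\<Sum>j\<in>I. c j * \<phi> j x) + c i * \<phi> i x)" using assms by (simp add: add.commute)
  moreover have "(\<lambda>x. \<Sum>j\<in>I. c j * \<phi> j x) \<in> lincombs \<phi> I" by (auto simp: lincombs_def)
  ultimately show "v \<in> {\<lambda>x. u x + t * \<phi> i x | u t. u \<in> lincombs \<phi> I}" by fast
next
  fix v assume "v \<in> {\<lambda>x. u x + t * \<phi> i x | u t. u \<in> lincombs \<phi> I}"
  then obtain c t where v: "v = (\<lambda>x. (\<Sum>j\<in>I. c j * \<phi> j x) + t * \<phi> i x)" by (auto simp: lincombs_def)
  have "(\<Sum>j\<in>I. c j * \<phi> j x) = (\<Sum>j\<in>I. (c(i := t)) j * \<phi> j x)" for x
    using assms by (intro sum.cong) auto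
  then have "v = (\<lambda>x. \<Sum>j\<in>insert i I. (c(i := t)) j * \<phi> j x)" using assms v by (simp add: add.commute)
  then show "v \<in> lincombs \<phi> (insert i I)" unfolding lincombs_def by blast
qed

text \<open>A Gram-Schmidt step by induction on the index set. The induction hypothesis, for
  arbitrary l, is applied to the functional \<open>a ?w\<close> of the new function as well as to l
  itself; subtracting the resulting r from the new function gives d with a(d, v) = 0 for all v in
  the smaller space. If d = 0 the space has not grown, so linear independence never enters;
  otherwise a(d, d) = a(d, ?w) is nonzero and a multiple of d corrects the old solution.\<close>

lemma definite_form_solvable:
  assumes "finite I"
    and "\<And>u v w s. \<lbrakk>u \<in> lincombs \<phi> I; v \<in> lincombs \<phi> I; w \<in> lincombs \<phi> I\<rbrakk> \<Longrightarrow>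
           a (\<lambda>x. u x + s * v x) w = a u w + s * a v w"
    and "\<And>u v w s. \<lbrakk>u \<in> lincombs \<phi> I; v \<in> lincombs \<phi> I; w \<in> lincombs \<phi> I\<rbrakk> \<Longrightarrow>
           a w (\<lambda>x. u x + s * v x) = a w u + s * a w v"
    and "\<And>u v s. \<lbrakk>u \<in> lincombs \<phi> I; v \<in> lincombs \<phi> I\<rbrakk> \<Longrightarrow> l (\<lambda>x. u x + s * v x) = l u + s * l v"
    and "\<And>u. \<lbrakk>u \<in> lincombs \<phi> I; a u u = 0\<rbrakk> \<Longrightarrow> u = (\<lambda>x. 0)"
  shows "\<exists>u\<in>lincombs \<phi> I. \<forall>v\<in>lincombs \<phi> I. a u v = l v"
  using assms
proof (induction I arbitrary: l rule: finite_induct)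
  case empty
  have z: "lincombs \<phi> {} = {\<lambda>x. 0}" by (auto simp: lincombs_def)
  have "l (\<lambda>x. 0) = 0" "a (\<lambda>x. 0) (\<lambda>x. 0) = 0"
    using empty(3)[of "\<lambda>x. 0" "\<lambda>x. 0" 1] empty(1)[of "\<lambda>x. 0" "\<lambda>x. 0" "\<lambda>x. 0" 1] by (simp_all add: z)
  then show ?case by (simp add: z)
next
  case (insert i I)
  let ?V = "lincombs \<phi> (insert i I)" and ?W = "lincombs \<phi> I" and ?w = "\<phi> i"
  have V: "?V = {\<lambda>x. u x + t * \<phi> i x | u t. u \<in> ?W}" using insert.hyps by (rule lincombs_insert)
  have sub: "u \<in> ?V" if "u \<in> ?W" for u
  proof -
    have "u = (\<lambda>x. u x + 0 * \<phi> i x)" by simp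
    then show ?thesis unfolding V using that by blast
  qed
  have z0: "(\<lambda>x. 0) \<in> ?W" unfolding lincombs_def by (rule image_eqI[of _ _ "\<lambda>_. 0"]) auto
  have wV: "?w \<in> ?V"
    unfolding V using z0 by (intro CollectI exI[of _ "\<lambda>x. 0"] exI[of _ 1]) auto
  note lin1 = insert.prems(1) and lin2 = insert.prems(2) and linl = insert.prems(3) and pd = insert.prems(4)
  have IH: "\<exists>u\<in>?W. \<forall>v\<in>?W. a u v = m v"
    if "\<And>u v s. \<lbrakk>u \<in> ?W; v \<in> ?W\<rbrakk> \<Longrightarrow> m (\<lambda>x. u x + s * v x) = m u + s * m v" for m
    by (rule insert.IH) (use lin1 lin2 pd sub that in auto)
  obtain r where r: "r \<in> ?W" "\<forall>v\<in>?W. a r v = a ?w v"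
    using IH[of "a ?w"] lin2 wV sub by blast
  obtain s where s: "s \<in> ?W" "\<forall>v\<in>?W. a s v = l v" using IH[of l] linl sub by blast
  define d where "d = (\<lambda>x. ?w x + (-1) * r x)"
  have dV: "d \<in> ?V" unfolding d_def by (intro lincombs_lin wV sub r)
  have ad: "a d v = 0" if "v \<in> ?W" for v
    unfolding d_def using lin1[OF wV sub[OF r(1)] sub[OF that], of "-1"] r(2) that by simp
  show ?case
  proof (cases "d = (\<lambda>x. 0)")
    case True
    then have "?w = r" by (auto simp: d_def fun_eq_iff)
    then have "?V = ?W" using V r(1) sub lincombs_lin[of _ \<phi> I r] by auto
    then show ?thesis using s by auto
  next
    case False
    have "a d d = a d ?w + (-1) * a d r"
      using lin2[OF wV sub[OF r(1)] dV, of "-1"] by (simp add: d_def)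
    then have dw: "a d ?w \<noteq> 0" using pd[OF dV] False ad[OF r(1)] by auto
    \<comment> \<open>This factor enforces the equation for the new test function; the equations on
      the smaller space survive because a(d, v) = 0 there.\<close>
    define t where "t = (l ?w - a s ?w) / a d ?w"
    define u where "u = (\<lambda>x. s x + t * d x)"
    have uV: "u \<in> ?V" unfolding u_def by (intro lincombs_lin dV sub s)
    have au: "a u v = a s v + t * a d v" if "v \<in> ?V" for v
      unfolding u_def by (rule lin1[OF sub[OF s(1)] dV that])
    have "a u v = l v" if vV: "v \<in> ?V" for v
    proof -
      obtain v' t' where v: "v = (\<lambda>x. v' x + t' * ?w x)" "v' \<in> ?W" 
        using vV unfolding V by auto
      have "a u v = a u v' + t' * a u ?w" unfolding v(1) by (rule lin2[OF sub[OF v(2)] wV uV])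
      also have "a u v' = l v'" using au[OF sub[OF v(2)]] ad[OF v(2)] s v(2) by simp
      also have "a u ?w = l ?w" using au[OF wV] dw by (simp add: t_def)
      also have "l v' + t' * l ?w = l v" unfolding v(1) by (rule linl[OF sub[OF v(2)] wV, symmetric])
      finally show ?thesis .
    qed
    then show ?thesis using uV by blast
  qed
qed

section \<open>Inverse and discrete trace inequalities\<close>

text \<open>The integral of (s f + t g)^2 is a nonnegative quadratic form in (s, t), and its
  discriminant gives the claim.\<close>

lemma integral_Cauchy_Schwarz:
  fixes f g :: "real \<Rightarrow> real"
  assumes "continuous_on {a..b} f" "continuous_on {a..b} g"
  shows "\<bar>integral {a..b} (\<lambda>x. f x * g x)\<bar>
           \<le> sqrt (integral {a..b} (\<lambda>x. (f x)\<^sup>2)) * sqrt (integral {a..b} (\<lambda>x. (g x)\<^sup>2))"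
proof -
  define A B C where "A = integral {a..b} (\<lambda>x. (f x)\<^sup>2)" and "B = integral {a..b} (\<lambda>x. f x * g x)"
    and "C = integral {a..b} (\<lambda>x. (g x)\<^sup>2)"
  have int: "(\<lambda>x. (f x)\<^sup>2) integrable_on {a..b}" "(\<lambda>x. f x * g x) integrable_on {a..b}"
    "(\<lambda>x. (g x)\<^sup>2) integrable_on {a..b}"
    by (intro integrable_continuous_interval continuous_intros assms)+
  have "A \<ge> 0" "C \<ge> 0" unfolding A_def C_def by (rule integral_nonneg; use int in simp)+
  have quad: "s\<^sup>2 * A + 2 * s * t * B + t\<^sup>2 * C \<ge> 0" for s t
  proof -
    have "((\<lambda>x. s\<^sup>2 * (f x)\<^sup>2 + (2 * s * t) * (f x * g x) + t\<^sup>2 * (g x)\<^sup>2) has_integral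
        (s\<^sup>2 * A + 2 * s * t * B + t\<^sup>2 * C)) {a..b}"
      unfolding A_def B_def C_def
      by (intro has_integral_add has_integral_mult_right integrable_integral int)
    then show ?thesis
    proof (rule has_integral_nonneg)
      fix x
      have "s\<^sup>2 * (f x)\<^sup>2 + (2 * s * t) * (f x * g x) + t\<^sup>2 * (g x)\<^sup>2 = (s * f x + t * g x)\<^sup>2"
        by (simp add: power2_eq_square algebra_simps)
      then show "0 \<le> s\<^sup>2 * (f x)\<^sup>2 + (2 * s * t) * (f x * g x) + t\<^sup>2 * (g x)\<^sup>2" by simp
    qed
  qed
  have "B\<^sup>2 \<le> A * C"
  proof (cases "C = 0")
    case True
    have "B = 0"
    proof (rule ccontr)
      assume "B \<noteq> 0"
      \<comment> \<open>For C = 0 the quadratic form takes the value A - (A + 1) = -1 at this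
        point.\<close>
      then show False using quad[of 1 "-(A+1)/(2*B)"] True \<open>A \<ge> 0\<close> by (simp add: field_simps)
    qed
    then show ?thesis using True by simp
  next
    case False
    \<comment> \<open>Evaluation at (C, -B), the minimizing direction, leaves a multiple of the
      discriminant.\<close>
    have "C * (A * C - B\<^sup>2) \<ge> 0" using quad[of C "-B"] by (simp add: power2_eq_square algebra_simps)
    then show ?thesis using False \<open>C \<ge> 0\<close> by (simp add: zero_le_mult_iff)
  qed
  then have "\<bar>B\<bar> \<le> sqrt (A * C)" by (metis real_sqrt_abs real_sqrt_le_mono)
  then show ?thesis by (simp add: A_def B_def C_def real_sqrt_mult)
qed

lemma poly_zero_if_integral_zero:
  fixes p :: "real poly"
  assumes "a < b" "integral {a..b} (\<lambda>x. (poly p x)\<^sup>2) = 0"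
  shows "p = 0"
proof (rule ccontr)
  assume "p \<noteq> 0"
  then have "finite {x. poly p x = 0}" by (rule poly_roots_finite)
  moreover have "{a..b} \<subseteq> {x. poly p x = 0}"
    using integral_eq_0_iff[of a b "\<lambda>x. (poly p x)\<^sup>2"] assms
    by (auto simp: continuous_on_power continuous_on_poly)
  ultimately show False using assms(1) by (meson finite_subset infinite_Icc)
qed

lemma poly_sum_coeff:
  fixes p :: "'a :: comm_semiring_1 poly"
  assumes "degree p \<le> n"
  shows "poly p x = (\<Sum>i\<le>n. coeff p i * x ^ i)"
proof -
  have "poly p x = poly (\<Sum>i\<le>n. monom (coeff p i) i) x" using assms by (simp add: poly_as_sum_of_monoms')
  then show ?thesis by (simp add: poly_sum poly_monom)
qed

lemma lincombs_monomials: "lincombs (\<lambda>i x. x ^ i) {..k} = poly ` {p :: real poly. degree p \<le> k}"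
proof (intro equalityI subsetI)
  fix u :: "real \<Rightarrow> real" assume "u \<in> lincombs (\<lambda>i x. x ^ i) {..k}"
  then obtain c where "u = (\<lambda>x. \<Sum>i\<le>k. c i * x ^ i)" by (auto simp: lincombs_def)
  then have "u = poly (\<Sum>i\<le>k. monom (c i) i)" by (simp add: fun_eq_iff poly_sum poly_monom)
  moreover have "degree (\<Sum>i\<le>k. monom (c i) i) \<le> k"
    by (intro degree_sum_le) (auto intro: order.trans[OF degree_monom_le])
  ultimately show "u \<in> poly ` {p. degree p \<le> k}" by blast
next
  fix u :: "real \<Rightarrow> real" assume "u \<in> poly ` {p. degree p \<le> k}"
  then obtain p where p: "u = poly p" "degree p \<le> k" by auto
  have "u = (\<lambda>x. \<Sum>i\<le>k. coeff p i * x ^ i)" 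
    unfolding p(1) using poly_sum_coeff[OF p(2)] by blast
  then show "u \<in> lincombs (\<lambda>i x. x ^ i) {..k}" by (auto simp: lincombs_def)
qed

text \<open>The coefficient functional is represented by some polynomial \<open>r\<close> in the $L^2(0,1)$ inner
  product, and Cauchy--Schwarz bounds it by the norm of \<open>r\<close>.\<close>
lemma coeff_bound_L2:
  "\<exists>M\<ge>0. \<forall>p :: real poly. degree p \<le> k \<longrightarrow> \<bar>coeff p i\<bar> \<le> M * sqrt (integral {0..1} (\<lambda>x. (poly p x)\<^sup>2))"
proof -
  let ?V = "lincombs (\<lambda>i (x::real). x ^ i) {..k}"
  \<comment> \<open>The solvability lemma speaks of functions, so the coefficient functional has to
    be read off a function; \<open>inv poly\<close> does this because distinct real polynomials are
    distinct functions.\<close>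
  define l where "l u = coeff (inv poly u :: real poly) i" for u
  have inj: "inj (poly :: real poly \<Rightarrow> _)" by (auto simp: inj_on_def poly_eq_poly_eq_iff)
  have l: "l (poly p) = coeff p i" for p unfolding l_def inv_f_f[OF inj] ..
  have lin: "(\<lambda>x. poly p x + s * poly q x) = poly (p + smult s q)" for p q :: "real poly" and s by (simp add: fun_eq_iff)
  have ci: "(\<lambda>x. poly p x * poly q x) integrable_on {0..1}" for p q :: "real poly"
    by (intro integrable_continuous_interval continuous_intros)
  have lin1: "integral {0..1} (\<lambda>x. (poly p x + s * poly q x) * poly r x) =
     integral {0..1} (\<lambda>x. poly p x * poly r x) + s * integral {0..1} (\<lambda>x. poly q x * poly r x)" for p q r :: "real poly" and s
  proof -
    have "((\<lambda>x. poly p x * poly r x + s * (poly q x * poly r x)) has_integral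
        integral {0..1} (\<lambda>x. poly p x * poly r x) + s * integral {0..1} (\<lambda>x. poly q x * poly r x)) {0..1}"
      by (intro has_integral_add has_integral_mult_right integrable_integral ci)
    then show ?thesis by (simp add: integral_unique algebra_simps)
  qed
  have lin2: "integral {0..1} (\<lambda>x. poly r x * (poly p x + s * poly q x)) =
     integral {0..1} (\<lambda>x. poly r x * poly p x) + s * integral {0..1} (\<lambda>x. poly r x * poly q x)"
    for p q r :: "real poly" and s
    using lin1[of p s q r] unfolding mult.commute[of _ "poly r _"] .
  have "\<exists>u\<in>?V. \<forall>v\<in>?V. integral {0..1} (\<lambda>x. u x * v x) = l v"
  proof (rule definite_form_solvable, goal_cases)
    case (2 u v w s)
    then show ?case by (auto simp: lincombs_monomials lin1)
  next
    case (3 u v w s)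
    then show ?case by (auto simp: lincombs_monomials lin2)
  next
    case (4 u v s)
    then show ?case by (auto simp: lincombs_monomials lin l)
  next
    case (5 u)
    then obtain p where p: "u = poly p" by (auto simp: lincombs_monomials)
    then have "p = 0" using 5 poly_zero_if_integral_zero[of 0 1 p] by (simp add: power2_eq_square)
    then show ?case using p by auto
  qed simp
  then obtain u where u: "u \<in> ?V" "\<And>v. v \<in> ?V \<Longrightarrow> integral {0..1} (\<lambda>x. u x * v x) = l v" by blast
  then obtain r where ur: "u = poly r" unfolding lincombs_monomials by blast
  have r: "integral {0..1} (\<lambda>x. poly r x * poly p x) = coeff p i" if "degree p \<le> k" for p
    using u(2)[of "poly p"] that unfolding ur lincombs_monomials l by blast
  show ?thesis
  proof (intro exI[of _ "sqrt (integral {0..1} (\<lambda>x. (poly r x)\<^sup>2))"] conjI allI impI)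
    show "0 \<le> sqrt (integral {0..1} (\<lambda>x. (poly r x)\<^sup>2))"
      by (simp add: integral_nonneg integrable_continuous_interval continuous_on_power continuous_on_poly)
    fix p :: "real poly" assume "degree p \<le> k"
    then show "\<bar>coeff p i\<bar> \<le> sqrt (integral {0..1} (\<lambda>x. (poly r x)\<^sup>2)) * sqrt (integral {0..1} (\<lambda>x. (poly p x)\<^sup>2))"
      using integral_Cauchy_Schwarz[of 0 1 "poly r" "poly p"] r by (simp add: continuous_on_poly)
  qed
qed

text \<open>Bounding the coefficients bounds p' pointwise on [0,1], where all powers of x are at
  most 1. The constant is crude, but only its existence matters.\<close>

lemma inverse_inequality_unit:
  "\<exists>C\<ge>0. \<forall>p :: real poly. degree p \<le> k \<longrightarrow>
     integral {0..1} (\<lambda>x. (poly (pderiv p) x)\<^sup>2) \<le> C * integral {0..1} (\<lambda>x. (poly p x)\<^sup>2)"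
proof -
  obtain M where M: "\<And>i. M i \<ge> 0"
    "\<And>i p. degree p \<le> k \<Longrightarrow> \<bar>coeff p i\<bar> \<le> M i * sqrt (integral {0..1} (\<lambda>x. (poly p x)\<^sup>2))"
    using coeff_bound_L2[of k] by metis
  \<comment> \<open>The coefficient of x^i in p' is i + 1 times that of x^(i+1) in p. The vanishing
    term i = k is kept, which avoids k - 1.\<close>
  define N where "N = (\<Sum>i\<le>k. real (Suc i) * M (Suc i))"
  have "integral {0..1} (\<lambda>x. (poly (pderiv p) x)\<^sup>2) \<le> N\<^sup>2 * integral {0..1} (\<lambda>x. (poly p x)\<^sup>2)"
    if p: "degree p \<le> k" for p :: "real poly"
  proof -
    let ?n = "sqrt (integral {0..1} (\<lambda>x. (poly p x)\<^sup>2))"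
    have n: "integral {0..1} (\<lambda>x. (poly p x)\<^sup>2) \<ge> 0"
      by (intro integral_nonneg integrable_continuous_interval continuous_intros) auto
    have "(poly (pderiv p) x)\<^sup>2 \<le> (N * ?n)\<^sup>2" if "x \<in> {0..1}" for x
    proof -
      have "degree (pderiv p) \<le> k" using p by (simp add: degree_pderiv)
      then have "poly (pderiv p) x = (\<Sum>i\<le>k. coeff (pderiv p) i * x ^ i)"
        by (rule poly_sum_coeff)
      also have "\<bar>\<dots>\<bar> \<le> (\<Sum>i\<le>k. \<bar>coeff (pderiv p) i * x ^ i\<bar>)" by (rule sum_abs)
      also have "\<dots> \<le> (\<Sum>i\<le>k. real (Suc i) * M (Suc i) * ?n)"
      proof (rule sum_mono)
        fix i
        have "\<bar>coeff (pderiv p) i * x ^ i\<bar> \<le> \<bar>coeff (pderiv p) i\<bar> * 1"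
          unfolding abs_mult using that by (intro mult_left_mono) (auto simp: power_le_one)
        also have "\<dots> = real (Suc i) * \<bar>coeff p (Suc i)\<bar>" by (simp add: coeff_pderiv abs_mult)
        also have "\<dots> \<le> real (Suc i) * (M (Suc i) * ?n)" by (intro mult_left_mono M p) auto
        finally show "\<bar>coeff (pderiv p) i * x ^ i\<bar> \<le> real (Suc i) * M (Suc i) * ?n" by simp
      qed
      also have "\<dots> = N * ?n" by (simp add: N_def sum_distrib_right)
      finally have "\<bar>poly (pderiv p) x\<bar> \<le> \<bar>N * ?n\<bar>" by simp
      then show ?thesis by (simp only: abs_le_square_iff)
    qed
    then have "integral {0..1} (\<lambda>x. (poly (pderiv p) x)\<^sup>2) \<le> integral {0..1} (\<lambda>x::real. (N * ?n)\<^sup>2)"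
      by (intro integral_le integrable_continuous_interval continuous_intros) auto
    also have "\<dots> = N\<^sup>2 * integral {0..1} (\<lambda>x. (poly p x)\<^sup>2)" using n by (simp add: power_mult_distrib)
    finally show ?thesis .
  qed
  then show ?thesis by (intro exI[of _ "N\<^sup>2"]) auto
qed

lemma integral_rescale_unit:
  fixes f :: "real \<Rightarrow> real"
  assumes "a < b" "continuous_on UNIV f"
  shows "integral {a..b} f = (b - a) * integral {0..1} (\<lambda>t. f (a + (b - a) * t))"
proof -
  have "((\<lambda>t. (b - a) *\<^sub>R f (a + (b - a) * t)) has_integral integral {a + (b - a) * 0..a + (b - a) * 1} f) {0..1}"
    using assms
    by (intro has_integral_substitution[of 0 1 _ a b f])
       (auto intro!: continuous_on_subset[OF assms(2)] derivative_eq_intros simp: algebra_simps affine_ineq mult_left_mono)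
  from integral_unique[OF this] show ?thesis using assms(1) by simp
qed

text \<open>This is the set whose infimum is \<open>C_ie k\<close>; a name for it lets nonemptiness
  be stated on its own.\<close>

definition inverse_constants :: "nat \<Rightarrow> real set" where
  "inverse_constants k = {C. 0 \<le> C \<and> (\<forall>a b (p :: real poly). a < b \<and> degree p \<le> k \<longrightarrow>
      sqrt (integral {a..b} (\<lambda>x. (poly (pderiv p) x)^2))
        \<le> sqrt C / (b - a) * sqrt (integral {a..b} (\<lambda>x. (poly p x)^2)))}"

text \<open>The substitution x = a + h t reduces every interval to [0,1]. Both integrals acquire the
  factor h, and the derivative an additional 1/h^2, whose root is the 1 / (b - a) in the
  inequality.\<close>

lemma inverse_constants_nonempty: "inverse_constants k \<noteq> {}"
proof -
  obtain C where C: "C \<ge> 0" "\<And>p :: real poly. degree p \<le> k \<Longrightarrow>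
     integral {0..1} (\<lambda>x. (poly (pderiv p) x)\<^sup>2) \<le> C * integral {0..1} (\<lambda>x. (poly p x)\<^sup>2)"
    using inverse_inequality_unit[of k] by auto
  have "sqrt (integral {a..b} (\<lambda>x. (poly (pderiv p) x)\<^sup>2))
      \<le> sqrt C / (b - a) * sqrt (integral {a..b} (\<lambda>x. (poly p x)\<^sup>2))"
    if ab: "a < b" and p: "degree p \<le> k" for a b and p :: "real poly"
  proof -
    define h where "h = b - a"
    define q where "q = pcompose p [:a, h:]"
    have h: "h > 0" using ab by (simp add: h_def)
    have q: "poly p (a + h * t) = poly q t" for t by (simp add: q_def poly_pcompose algebra_simps)
    have q': "poly (pderiv p) (a + h * t) = poly (pderiv q) t / h" for t
      using h by (simp add: q_def pderiv_pcompose poly_pcompose pderiv_pCons algebra_simps)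
    have 1: "integral {a..b} (\<lambda>x. (poly p x)\<^sup>2) = h * integral {0..1} (\<lambda>t. (poly q t)\<^sup>2)"
      using integral_rescale_unit[OF ab, of "\<lambda>x. (poly p x)\<^sup>2"]
      by (simp add: continuous_on_power continuous_on_poly q flip: h_def)
    have 2: "integral {a..b} (\<lambda>x. (poly (pderiv p) x)\<^sup>2) = h * (integral {0..1} (\<lambda>t. (poly (pderiv q) t)\<^sup>2) / h\<^sup>2)"
      using integral_rescale_unit[OF ab, of "\<lambda>x. (poly (pderiv p) x)\<^sup>2"]
      by (simp add: continuous_on_power continuous_on_poly q' power_divide flip: h_def)
    have "degree q \<le> k" unfolding q_def using p h by (simp add: degree_pcompose)
    from C(2)[OF this] have "h * (integral {0..1} (\<lambda>t. (poly (pderiv q) t)\<^sup>2) / h\<^sup>2)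
        \<le> h * (C * integral {0..1} (\<lambda>x. (poly q x)\<^sup>2) / h\<^sup>2)"
      using h by (intro mult_left_mono divide_right_mono) auto
    then have "integral {a..b} (\<lambda>x. (poly (pderiv p) x)\<^sup>2) \<le> C / h\<^sup>2 * integral {a..b} (\<lambda>x. (poly p x)\<^sup>2)"
      unfolding 1 2 by (simp add: field_simps)
    then have "sqrt (integral {a..b} (\<lambda>x. (poly (pderiv p) x)\<^sup>2))
       \<le> sqrt (C / h\<^sup>2 * integral {a..b} (\<lambda>x. (poly p x)\<^sup>2))" by (rule real_sqrt_le_mono)
    then show ?thesis using h by (simp add: real_sqrt_mult real_sqrt_divide flip: h_def)
  qed
  then show ?thesis unfolding inverse_constants_def using C(1) by blast
qed

lemma C_ie_nonneg: "C_ie k \<ge> 0"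
  unfolding C_ie_def inverse_constants_def[symmetric]
  by (rule cInf_greatest[OF inverse_constants_nonempty]) (simp add: inverse_constants_def)

text \<open>The infimum is itself admissible: for a fixed nonzero p, every admissible constant is at
  least the same squared ratio of norms, so the infimum is too.\<close>

lemma inverse_inequality:
  fixes p :: "real poly"
  assumes "a < b" "degree p \<le> k"
  shows "sqrt (integral {a..b} (\<lambda>x. (poly (pderiv p) x)\<^sup>2))
        \<le> sqrt (C_ie k) / (b - a) * sqrt (integral {a..b} (\<lambda>x. (poly p x)\<^sup>2))" (is "?d \<le> _ * ?n")
proof (cases "p = 0")
  case True
  then show ?thesis by simp
next
  case False
  have "integral {a..b} (\<lambda>x. (poly p x)\<^sup>2) \<ge> 0"
    by (intro integral_nonneg integrable_continuous_interval continuous_intros) auto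
  moreover have "integral {a..b} (\<lambda>x. (poly p x)\<^sup>2) \<noteq> 0"
    using poly_zero_if_integral_zero[OF assms(1)] False by blast
  ultimately have n: "?n > 0" by simp
  have "?d \<ge> 0" by (intro real_sqrt_ge_zero integral_nonneg integrable_continuous_interval continuous_intros) auto
  have "(?d * (b - a) / ?n)\<^sup>2 \<le> C_ie k"
    unfolding C_ie_def inverse_constants_def[symmetric]
  proof (rule cInf_greatest[OF inverse_constants_nonempty])
    fix C assume C: "C \<in> inverse_constants k"
    then have "?d \<le> sqrt C / (b - a) * ?n" using assms unfolding inverse_constants_def by blast
    then have "?d * (b - a) / ?n \<le> sqrt C" using n assms(1) by (simp add: field_simps)
    then have "(?d * (b - a) / ?n)\<^sup>2 \<le> (sqrt C)\<^sup>2" using \<open>?d \<ge> 0\<close> n assms(1) by (intro power_mono) auto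
    then show "(?d * (b - a) / ?n)\<^sup>2 \<le> C" using C by (simp add: inverse_constants_def)
  qed
  then have "?d * (b - a) / ?n \<le> sqrt (C_ie k)" by (rule real_le_rsqrt)
  then show ?thesis using n assms(1) by (simp add: field_simps)
qed

lemma C_dt_ge_1: "C_dt k \<ge> 1"
  by (simp add: C_dt_def C_ie_nonneg)

text \<open>Integrate the derivative of \<open>(z - d) p(z)^2\<close>, where \<open>d\<close> is the end point opposite to \<open>e\<close>.\<close>
lemma discrete_trace_inequality:
  fixes p :: "real poly"
  assumes "a < b" "degree p \<le> k" "e = a \<or> e = b"
  shows "(poly p e)\<^sup>2 \<le> C_dt k / (b - a) * integral {a..b} (\<lambda>x. (poly p x)\<^sup>2)"
proof -
  define d where "d = a + b - e"
  define N where "N = integral {a..b} (\<lambda>x. (poly p x)\<^sup>2)"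
  define X where "X = integral {a..b} (\<lambda>x. ((x - d) * poly (pderiv p) x) * poly p x)"
  have ii: "(\<lambda>x. (poly p x)\<^sup>2) integrable_on {a..b}" "(\<lambda>x. ((x - d) * poly (pderiv p) x) * poly p x) integrable_on {a..b}"
    "(\<lambda>x. (poly (pderiv p) x)\<^sup>2) integrable_on {a..b}" "(\<lambda>x. ((x - d) * poly (pderiv p) x)\<^sup>2) integrable_on {a..b}"
    by (intro integrable_continuous_interval continuous_intros)+
  have N0: "N \<ge> 0" unfolding N_def using ii by (intro integral_nonneg) auto
  have "((\<lambda>x. (poly p x)\<^sup>2 + 2 * (((x - d) * poly (pderiv p) x) * poly p x)) has_integral
     (b - d) * (poly p b)\<^sup>2 - (a - d) * (poly p a)\<^sup>2) {a..b}"
    using assms(1)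
    by (intro fundamental_theorem_of_calculus)
       (auto intro!: derivative_eq_intros simp: has_real_derivative_iff_has_vector_derivative[symmetric]
          algebra_simps power2_eq_square)
  moreover have "((\<lambda>x. (poly p x)\<^sup>2 + 2 * (((x - d) * poly (pderiv p) x) * poly p x)) has_integral (N + 2 * X)) {a..b}"
    unfolding N_def X_def by (intro has_integral_add has_integral_mult_right integrable_integral ii)
  ultimately have eq: "(b - d) * (poly p b)\<^sup>2 - (a - d) * (poly p a)\<^sup>2 = N + 2 * X" by (rule has_integral_unique)
  have lhs: "(b - d) * (poly p b)\<^sup>2 - (a - d) * (poly p a)\<^sup>2 = (b - a) * (poly p e)\<^sup>2"
    using assms(3) by (auto simp: d_def algebra_simps)
  have "X \<le> sqrt (integral {a..b} (\<lambda>x. ((x - d) * poly (pderiv p) x)\<^sup>2)) * sqrt N"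
    using integral_Cauchy_Schwarz[of a b "\<lambda>x. (x - d) * poly (pderiv p) x" "poly p"]
    unfolding X_def N_def by (simp add: continuous_on_mult continuous_on_diff continuous_on_poly abs_le_iff)
  also have "\<dots> \<le> sqrt ((b - a)\<^sup>2 * integral {a..b} (\<lambda>x. (poly (pderiv p) x)\<^sup>2)) * sqrt N"
  proof (intro mult_right_mono real_sqrt_le_mono)
    have "integral {a..b} (\<lambda>x. ((x - d) * poly (pderiv p) x)\<^sup>2) \<le> integral {a..b} (\<lambda>x. (b - a)\<^sup>2 * (poly (pderiv p) x)\<^sup>2)"
      unfolding power_mult_distrib
    proof (intro integral_le mult_right_mono)
      fix x assume "x \<in> {a..b}"
      then have "\<bar>x - d\<bar> \<le> b - a" using assms(3) by (auto simp: d_def)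
      then show "(x - d)\<^sup>2 \<le> (b - a)\<^sup>2" using assms(1) by (metis abs_le_square_iff abs_of_pos diff_gt_0_iff_gt)
    qed (use ii in \<open>auto simp: power_mult_distrib intro!: integrable_on_mult_right\<close>)
    then show "integral {a..b} (\<lambda>x. ((x - d) * poly (pderiv p) x)\<^sup>2) \<le> (b - a)\<^sup>2 * integral {a..b} (\<lambda>x. (poly (pderiv p) x)\<^sup>2)"
      by simp
  qed (use N0 in auto)
  also have "\<dots> = (b - a) * sqrt (integral {a..b} (\<lambda>x. (poly (pderiv p) x)\<^sup>2)) * sqrt N"
    using assms(1) by (simp add: real_sqrt_mult)
  also have "\<dots> \<le> (b - a) * (sqrt (C_ie k) / (b - a) * sqrt N) * sqrt N"
    using assms(1) inverse_inequality[OF assms(1,2)] N0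
    by (intro mult_right_mono mult_left_mono) (auto simp: N_def)
  also have "\<dots> = sqrt (C_ie k) * N" using assms(1) N0 by simp
  \<comment> \<open>The bound N + 2 X \<le> (1 + 2 sqrt (C_ie k)) N is the origin of the constant
    \<open>C_dt\<close>.\<close>
  finally have "(b - a) * (poly p e)\<^sup>2 \<le> C_dt k * N" using eq lhs by (simp add: C_dt_def algebra_simps)
  then show ?thesis using assms(1) by (simp add: N_def field_simps)
qed

section \<open>Bounded Borel functions and Fubini\<close>

text \<open>A class closed under sums, products, slices and integration over one variable, whose
  members are integrable on every bounded Borel set. Working inside it discharges the side
  conditions of Fubini by closure rules alone.\<close>

definition bdd_borel :: "('a::topological_space \<Rightarrow> real) \<Rightarrow> bool" where
  "bdd_borel f \<longleftrightarrow> f \<in> borel_measurable borel \<and> (\<exists>B. \<forall>x. \<bar>f x\<bar> \<le> B)"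

lemma bdd_borel_measurable: "bdd_borel f \<Longrightarrow> f \<in> borel_measurable borel"
  by (simp add: bdd_borel_def)

lemma bdd_borel_const: "bdd_borel (\<lambda>x. c)"
  by (auto simp: bdd_borel_def)

lemma bdd_borel_add:
  assumes "bdd_borel f" "bdd_borel g"
  shows "bdd_borel (\<lambda>x. f x + g x)"
proof -
  obtain A B where "\<And>x. \<bar>f x\<bar> \<le> A" "\<And>x. \<bar>g x\<bar> \<le> B" using assms by (auto simp: bdd_borel_def)
  then have "\<bar>f x + g x\<bar> \<le> A + B" for x by (meson abs_triangle_ineq add_mono order_trans)
  then show ?thesis using assms by (auto simp: bdd_borel_def)
qed

lemma bdd_borel_mult:
  assumes "bdd_borel f" "bdd_borel g"
  shows "bdd_borel (\<lambda>x. f x * g x)"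
proof -
  obtain A B where AB: "\<And>x. \<bar>f x\<bar> \<le> A" "\<And>x. \<bar>g x\<bar> \<le> B" using assms by (auto simp: bdd_borel_def)
  have "\<bar>f x * g x\<bar> \<le> A * B" for x
    unfolding abs_mult by (intro mult_mono AB) (use AB(1)[of x] in auto)
  then show ?thesis using assms by (auto simp: bdd_borel_def)
qed

lemma bdd_borel_sum: "(\<And>i. i \<in> I \<Longrightarrow> bdd_borel (f i)) \<Longrightarrow> bdd_borel (\<lambda>x. \<Sum>i\<in>I. f i x)"
  by (induction I rule: infinite_finite_induct) (auto intro: bdd_borel_const bdd_borel_add)

text \<open>Extended polynomial pieces are unbounded on the plane; cutting them off on a bounded
  element or interval brings them into the class.\<close>

lemma bdd_borel_indicator_continuous:
  fixes f :: "'a::euclidean_space \<Rightarrow> real"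
  assumes "S \<in> sets borel" "bounded S" "continuous_on UNIV f"
  shows "bdd_borel (\<lambda>x. indicator S x * f x)"
proof -
  have "compact (f ` closure S)"
    using assms by (intro compact_continuous_image continuous_on_subset[OF assms(3)]) auto
  then obtain B where B: "\<And>x. x \<in> closure S \<Longrightarrow> \<bar>f x\<bar> \<le> B"
    using compact_imp_bounded bounded_real by (metis image_eqI)
  have "\<bar>indicator S x * f x\<bar> \<le> max 0 B" for x
    using B[of x] closure_subset[of S] by (cases "x \<in> S") auto
  moreover have "f \<in> borel_measurable borel" using assms(3) by (rule borel_measurable_continuous_onI)
  ultimately show ?thesis using assms(1) by (auto simp: bdd_borel_def)
qed

lemma measurable_lebesgue_on_borel:
  fixes f :: "'a::euclidean_space \<Rightarrow> real"
  shows "f \<in> borel_measurable borel \<Longrightarrow> f \<in> borel_measurable (lebesgue_on S)"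
  by (intro measurable_restrict_space1 measurable_completion) simp

lemma bdd_borel_integrable:
  fixes f :: "'a::euclidean_space \<Rightarrow> real"
  assumes "bdd_borel f" "S \<in> sets borel" "bounded S"
  shows "integrable (lebesgue_on S) f"
proof -
  have "S \<in> lmeasurable" using assms by (intro bounded_set_imp_lmeasurable) auto
  then interpret finite_measure "lebesgue_on S" by (rule finite_measure_lebesgue_on)
  obtain B where "\<And>x. \<bar>f x\<bar> \<le> B" using assms by (auto simp: bdd_borel_def)
  then show ?thesis
    by (intro integrable_const_bound[of _ B] measurable_lebesgue_on_borel bdd_borel_measurable assms) auto
qed

lemma continuous_integrable_bounded:
  fixes f :: "'a::euclidean_space \<Rightarrow> real"
  assumes "continuous_on UNIV f" "S \<in> sets borel" "bounded S"
  shows "integrable (lebesgue_on S) f"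
proof -
  have "integrable (lebesgue_on S) (\<lambda>x. indicator S x * f x)"
    using assms by (intro bdd_borel_integrable bdd_borel_indicator_continuous)
  then show ?thesis by (rule Bochner_Integration.integrable_cong[THEN iffD1, rotated 2]) (auto simp: space_restrict_space)
qed

lemma lebesgue_on_integral_lborel:
  fixes f :: "'a::euclidean_space \<Rightarrow> real"
  assumes "S \<in> sets borel" "f \<in> borel_measurable borel"
  shows "(LINT x|lebesgue_on S. f x) = (LINT x|lborel. indicator S x * f x)"
proof -
  have "(LINT x|lebesgue_on S. f x) = (LINT x|lebesgue. indicator S x *\<^sub>R f x)"
    using assms by (intro integral_restrict_space) auto
  also have "\<dots> = (LINT x|lborel. indicator S x *\<^sub>R f x)"
    using assms by (intro integral_completion) auto
  finally show ?thesis by simp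
qed

lemma bdd_borel_slice: "bdd_borel (f :: real \<times> real \<Rightarrow> real) \<Longrightarrow> bdd_borel (\<lambda>y. f (x, y))"
  and bdd_borel_slice': "bdd_borel (f :: real \<times> real \<Rightarrow> real) \<Longrightarrow> bdd_borel (\<lambda>y. f (y, x))"
  unfolding bdd_borel_def by (auto simp: borel_prod[symmetric])

lemma bdd_borel_fst: "bdd_borel f \<Longrightarrow> bdd_borel (\<lambda>x :: real \<times> real. f (fst x))"
  unfolding bdd_borel_def by (auto simp: borel_prod[symmetric])

lemma bdd_borel_swap:
  fixes f :: "real \<times> real \<Rightarrow> real"
  assumes "bdd_borel f"
  shows "bdd_borel (\<lambda>q. f (snd q, fst q))"
proof -
  have [measurable]: "f \<in> borel_measurable (borel \<Otimes>\<^sub>M borel)" using assms by (simp add: bdd_borel_def borel_prod)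
  have "(\<lambda>q. f (snd q, fst q)) \<in> borel_measurable (borel \<Otimes>\<^sub>M borel)" by measurable
  then show ?thesis using assms by (auto simp: bdd_borel_def borel_prod)
qed

lemma bdd_borel_slice_integral:
  fixes f :: "real \<times> real \<Rightarrow> real"
  assumes "bdd_borel f" "S \<in> sets borel" "bounded S"
  shows "bdd_borel (\<lambda>x. LINT y|lebesgue_on S. f (x, y))"
proof -
  obtain B where B: "\<And>x. \<bar>f x\<bar> \<le> B" using assms by (auto simp: bdd_borel_def)
  have [measurable]: "f \<in> borel_measurable (borel \<Otimes>\<^sub>M borel)" "S \<in> sets borel"
    using assms by (auto simp: bdd_borel_def borel_prod)
  have "S \<in> lmeasurable" using assms by (intro bounded_set_imp_lmeasurable) auto
  then interpret finite_measure "lebesgue_on S" by (rule finite_measure_lebesgue_on)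
  have "(\<lambda>x. LINT y|lebesgue_on S. f (x, y)) = (\<lambda>x. LINT y|lborel. indicator S y * f (x, y))"
    using assms by (intro ext lebesgue_on_integral_lborel) auto
  moreover have "(\<lambda>x. LINT y|lborel. indicator S y * f (x, y)) \<in> borel_measurable borel"
    by measurable
  moreover have "\<bar>LINT y|lebesgue_on S. f (x, y)\<bar> \<le> measure (lebesgue_on S) (space (lebesgue_on S)) * B" for x
  proof -
    have "\<bar>LINT y|lebesgue_on S. f (x, y)\<bar> \<le> (LINT y|lebesgue_on S. \<bar>f (x, y)\<bar>)"
      by (rule integral_abs_bound)
    also have "\<dots> \<le> (LINT y|lebesgue_on S. B)"
      using bdd_borel_slice[OF assms(1), of x] assms B
      by (intro integral_mono integrable_abs bdd_borel_integrable bdd_borel_const) auto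
    finally show ?thesis by simp
  qed
  ultimately show ?thesis unfolding bdd_borel_def by auto
qed

text \<open>\<open>lebesgue\<close> on the plane is a completion and not the product of the
  one-dimensional ones. As f is Borel, every integral can be moved to \<open>lborel\<close>, which
  is a genuine product measure.\<close>

lemma Fubini_rectangle:
  fixes f :: "real \<times> real \<Rightarrow> real"
  assumes "bdd_borel f" "A \<in> sets borel" "bounded A" "B \<in> sets borel" "bounded B"
  shows "(LINT x|lebesgue_on (A \<times> B). f x) = (LINT x|lebesgue_on A. LINT y|lebesgue_on B. f (x, y))"
    and "(LINT x|lebesgue_on (A \<times> B). f x) = (LINT y|lebesgue_on B. LINT x|lebesgue_on A. f (x, y))"
proof -
  have AB: "A \<times> B \<in> sets borel" using assms by (simp flip: borel_prod)
  let ?g = "\<lambda>x. indicator (A \<times> B) x * f x"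
  have f1: "f \<in> borel_measurable borel"
    using assms by (simp add: bdd_borel_def)
  have "integrable (lebesgue_on (A \<times> B)) f"
    using assms AB by (intro bdd_borel_integrable bounded_Times)
  then have "integrable lebesgue (\<lambda>x. indicator (A \<times> B) x *\<^sub>R f x)"
    using AB by (subst (asm) integrable_restrict_space) auto
  then have int: "integrable (lborel \<Otimes>\<^sub>M lborel) ?g"
    using AB f1 by (subst (asm) integrable_completion) (auto simp: lborel_prod)
  have 1: "(LINT x|lebesgue_on (A \<times> B). f x) = (LINT x|(lborel \<Otimes>\<^sub>M lborel). ?g x)"
    using lebesgue_on_integral_lborel[OF AB f1] by (simp add: lborel_prod)
  have sl: "bdd_borel (\<lambda>y. f (x, y))" "bdd_borel (\<lambda>y. f (y, x))" for x
    using assms bdd_borel_slice bdd_borel_slice' by auto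
  have "(LINT x|lebesgue_on A. LINT y|lebesgue_on B. f (x, y)) =
      (LINT x|lborel. indicator A x * (LINT y|lebesgue_on B. f (x, y)))"
    by (intro lebesgue_on_integral_lborel bdd_borel_measurable bdd_borel_slice_integral assms)
  also have "\<dots> = (LINT x|lborel. LINT y|lborel. ?g (x, y))"
    using sl assms by (simp add: lebesgue_on_integral_lborel bdd_borel_measurable indicator_times mult.assoc)
  finally show "(LINT x|lebesgue_on (A \<times> B). f x) = (LINT x|lebesgue_on A. LINT y|lebesgue_on B. f (x, y))"
    using lborel_pair.integral_fst'[OF int] 1 by simp
  have "(LINT y|lebesgue_on B. LINT x|lebesgue_on A. f (x, y)) =
      (LINT y|lborel. indicator B y * (LINT x|lebesgue_on A. f (x, y)))"
    using bdd_borel_slice_integral[OF bdd_borel_swap[OF assms(1)] assms(2,3)]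
    by (intro lebesgue_on_integral_lborel bdd_borel_measurable assms) simp
  also have "\<dots> = (LINT y|lborel. LINT x|lborel. ?g (x, y))"
  proof -
    have g: "?g (x, y) = indicator B y * (indicator A x * f (x, y))" for x y by (simp add: indicator_times)
    show ?thesis unfolding g using sl assms by (simp add: lebesgue_on_integral_lborel bdd_borel_measurable)
  qed
  finally show "(LINT x|lebesgue_on (A \<times> B). f x) = (LINT y|lebesgue_on B. LINT x|lebesgue_on A. f (x, y))"
    using lborel_pair.integral_snd[of "\<lambda>x y. ?g (x, y)"] int 1 by (simp add: case_prod_unfold)
qed

text \<open>A null set of z-values times the whole line is null in the plane. This lifts the
  conditions on the coefficients from (0,L) to \<open>Omega L\<close>.\<close>

lemma AE_lebesgue_on_fst:
  fixes P :: "real \<Rightarrow> bool"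
  assumes "AE z in lebesgue_on A. P z" "A \<in> sets borel" "(B :: real set) \<in> sets borel"
  shows "AE x in lebesgue_on (A \<times> B). P (fst x)"
proof -
  have AB: "A \<times> B \<in> sets (borel :: (real \<times> real) measure)" using assms by (simp flip: borel_prod)
  have "AE z in lborel. z \<in> A \<longrightarrow> P z"
    using assms by (simp add: AE_restrict_space_iff AE_completion_iff)
  then obtain N where N: "N \<in> null_sets lborel" "{z. \<not> (z \<in> A \<longrightarrow> P z)} \<subseteq> N"
    unfolding eventually_ae_filter by auto
  have "N \<times> UNIV \<in> null_sets (lborel \<Otimes>\<^sub>M (lborel :: real measure))"
    using N(1) by (intro lborel.times_in_null_sets1) auto
  then have "N \<times> UNIV \<in> null_sets (lborel :: (real \<times> real) measure)" by (simp add: lborel_prod)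
  then have "AE x in (lborel :: (real \<times> real) measure). x \<notin> N \<times> UNIV" by (rule AE_not_in)
  then have "AE x in (lborel :: (real \<times> real) measure). x \<in> A \<times> B \<longrightarrow> P (fst x)"
    by eventually_elim (use N(2) in auto)
  then show ?thesis using AB by (simp add: AE_restrict_space_iff AE_completion_iff)
qed

lemma AE_lebesgue_on_finite:
  assumes "finite Z" "A \<in> sets borel"
  shows "AE z in lebesgue_on A. (z :: real) \<notin> Z"
proof -
  have "AE z in lborel. z \<notin> Z" using assms(1) by (intro AE_not_in) (simp add: finite_imp_null_set_lborel)
  then have "AE z in lborel. z \<in> A \<longrightarrow> z \<notin> Z" by eventually_elim simp
  then show ?thesis using assms(2) by (simp add: AE_restrict_space_iff AE_completion_iff)
qed

text \<open>The truncation makes the Borel representative bounded and nonnegative everywhere.\<close>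
lemma bdd_borel_representative:
  fixes f :: "real \<Rightarrow> real"
  assumes "f \<in> borel_measurable (lebesgue_on A)" "A \<in> sets borel"
    and "AE z in lebesgue_on A. 0 \<le> f z" "AE z in lebesgue_on A. \<bar>f z\<bar> \<le> B"
  obtains f' where "bdd_borel f'" "\<And>z. f' z \<ge> 0" "AE z in lebesgue_on A. f z = f' z"
proof -
  have "(\<lambda>z. if z \<in> A then f z else 0) \<in> borel_measurable lebesgue"
    using assms(1,2) by (subst borel_measurable_if) auto
  then obtain g where g: "g \<in> borel_measurable lborel" "AE z in lborel. (if z \<in> A then f z else 0) = g z"
    using completion_ex_borel_measurable_real by blast
  define f' where "f' z = max 0 (min \<bar>B\<bar> (g z))" for z
  have "AE z in lborel. z \<in> A \<longrightarrow> 0 \<le> f z" "AE z in lborel. z \<in> A \<longrightarrow> \<bar>f z\<bar> \<le> B"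
    using assms by (auto simp: AE_restrict_space_iff AE_completion_iff)
  with g(2) have "AE z in lborel. z \<in> A \<longrightarrow> f z = f' z"
    by eventually_elim (auto simp: f'_def)
  then have "AE z in lebesgue_on A. f z = f' z"
    using assms(2) by (simp add: AE_restrict_space_iff AE_completion_iff)
  moreover have "bdd_borel f'"
    unfolding bdd_borel_def f'_def using g(1) by (auto intro!: exI[of _ "\<bar>B\<bar>"])
  moreover have "f' z \<ge> 0" for z by (simp add: f'_def)
  ultimately show thesis using that by blast
qed

section \<open>Piecewise functions on a mesh\<close>

definition pw :: "rect set \<Rightarrow> (rect \<Rightarrow> real \<times> real \<Rightarrow> real) \<Rightarrow> real \<times> real \<Rightarrow> real" where
  "pw T w p = (\<Sum>K\<in>T. indicator (rect_set K) p * w K p)"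

text \<open>Closed form of the limit of \<open>pw T w\<close> from the left. An element contributes
  when it lies immediately to the left of z, so z may equal its right edge but not its left
  edge.\<close>

definition left_trace :: "rect set \<Rightarrow> (rect \<Rightarrow> real \<times> real \<Rightarrow> real) \<Rightarrow> real \<Rightarrow> real \<Rightarrow> real" where
  "left_trace T w z \<mu> =
     (\<Sum>K\<in>T. if zl K < z \<and> z \<le> zr K then indicator {ml K<..<mr K} \<mu> * w K (z, \<mu>) else 0)"

definition right_trace :: "rect set \<Rightarrow> (rect \<Rightarrow> real \<times> real \<Rightarrow> real) \<Rightarrow> real \<Rightarrow> real \<Rightarrow> real" where
  "right_trace T w z \<mu> =
     (\<Sum>K\<in>T. if zl K \<le> z \<and> z < zr K then indicator {ml K<..<mr K} \<mu> * w K (z, \<mu>) else 0)"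

text \<open>\<open>w\<close> and \<open>w'\<close> extend the pieces of \<open>u\<close> and their \<open>z\<close>-derivatives to the whole plane.\<close>
definition represents :: "rect set \<Rightarrow> (real \<times> real \<Rightarrow> real) \<Rightarrow> (rect \<Rightarrow> real \<times> real \<Rightarrow> real) \<Rightarrow>
    (rect \<Rightarrow> real \<times> real \<Rightarrow> real) \<Rightarrow> bool" where
  "represents T u w w' \<longleftrightarrow> u = pw T w \<and> (\<forall>K\<in>T. continuous_on UNIV (w K) \<and> continuous_on UNIV (w' K) \<and>
     (\<forall>z \<mu>. ((\<lambda>t. w K (t, \<mu>)) has_real_derivative w' K (z, \<mu>)) (at z)))"

lemma represents_lin:
  assumes "represents T u w w'" "represents T v x x'"
  shows "represents T (\<lambda>p. u p + s * v p) (\<lambda>K p. w K p + s * x K p) (\<lambda>K p. w' K p + s * x' K p)"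
  using assms unfolding represents_def
  by (auto intro!: continuous_intros derivative_intros DERIV_cmult
      simp: pw_def sum.distrib sum_distrib_left algebra_simps fun_eq_iff)

lemma open_rect_set: "open (rect_set K)" and bounded_rect_set: "bounded (rect_set K)"
  by (auto simp: rect_set_def open_Times bounded_Times)

lemma open_Omega: "open (Omega L)" and bounded_Omega: "bounded (Omega L)"
  by (auto simp: Omega_def open_Times bounded_Times)

lemma mem_rect_set: "(z, \<mu>) \<in> rect_set K \<longleftrightarrow> zl K < z \<and> z < zr K \<and> ml K < \<mu> \<and> \<mu> < mr K"
  by (auto simp: rect_set_def)

lemma continuous_on_slice:
  fixes f :: "real \<times> real \<Rightarrow> real"
  shows "continuous_on UNIV f \<Longrightarrow> continuous_on UNIV (\<lambda>y. f (x, y))"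
    and "continuous_on UNIV f \<Longrightarrow> continuous_on UNIV (\<lambda>y. f (y, x))"
  by (rule continuous_on_compose2[where f="\<lambda>y. (x, y)" and g=f and t=UNIV]; auto intro!: continuous_intros)
     (rule continuous_on_compose2[where f="\<lambda>y. (y, x)" and g=f and t=UNIV]; auto intro!: continuous_intros)

lemma bdd_borel_pw: "\<forall>K\<in>T. continuous_on UNIV (w K) \<Longrightarrow> bdd_borel (pw T w)"
  unfolding pw_def[abs_def] using open_rect_set bounded_rect_set
  by (intro bdd_borel_sum bdd_borel_indicator_continuous) auto

lemma bdd_borel_if: "(P \<Longrightarrow> bdd_borel f) \<Longrightarrow> bdd_borel (\<lambda>x. if P then f x else 0)"
  by (cases P) (auto simp: bdd_borel_const)

lemma bdd_borel_left_trace: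
  "\<forall>K\<in>T. continuous_on UNIV (w K) \<Longrightarrow> bdd_borel (left_trace T w z)"
  unfolding left_trace_def[abs_def]
  by (intro bdd_borel_sum bdd_borel_if bdd_borel_indicator_continuous continuous_on_slice) auto

lemma bdd_borel_right_trace:
  "\<forall>K\<in>T. continuous_on UNIV (w K) \<Longrightarrow> bdd_borel (right_trace T w z)"
  unfolding right_trace_def[abs_def]
  by (intro bdd_borel_sum bdd_borel_if bdd_borel_indicator_continuous continuous_on_slice) auto

text \<open>In each summand the indicator is eventually constant as t approaches z from the left, so
  only continuity of the piece remains; the three cases are the possible positions of z relative to
  the element.\<close>

lemma tendsto_left_trace:
  assumes "\<forall>K\<in>T. continuous_on UNIV (w K)"
  shows "((\<lambda>t. pw T w (t, \<mu>)) \<longlongrightarrow> left_trace T w z \<mu>) (at_left z)"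
  unfolding pw_def left_trace_def
proof (rule tendsto_sum)
  fix K assume K: "K \<in> T"
  have c: "((\<lambda>t. w K (t, \<mu>)) \<longlongrightarrow> w K (z, \<mu>)) (at_left z)"
    using continuous_on_slice(2)[OF assms[rule_format, OF K], of \<mu>]
    by (auto simp: continuous_on_eq_continuous_at intro: isCont_tendsto_compose continuous_within_tendsto_compose
        filterlim_mono[OF _ order_refl at_le] simp: isCont_def)
  consider "zl K < z \<and> z \<le> zr K" | "z \<le> zl K" | "zr K < z" by linarith
  then show "((\<lambda>t. indicator (rect_set K) (t, \<mu>) * w K (t, \<mu>)) \<longlongrightarrow>
      (if zl K < z \<and> z \<le> zr K then indicator {ml K<..<mr K} \<mu> * w K (z, \<mu>) else 0)) (at_left z)"
  proof cases
    case 1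
    have "\<forall>\<^sub>F t in at_left z. t \<in> {zl K<..<z}" using 1 by (intro eventually_at_leftI[of "zl K"]) auto
    then have "\<forall>\<^sub>F t in at_left z. indicator {ml K<..<mr K} \<mu> * w K (t, \<mu>) = indicator (rect_set K) (t, \<mu>) * w K (t, \<mu>)"
      by eventually_elim (use 1 in \<open>auto simp: mem_rect_set indicator_def\<close>)
    moreover have "((\<lambda>t. indicator {ml K<..<mr K} \<mu> * w K (t, \<mu>)) \<longlongrightarrow> indicator {ml K<..<mr K} \<mu> * w K (z, \<mu>)) (at_left z)"
      by (intro tendsto_intros c)
    ultimately have "((\<lambda>t. indicator (rect_set K) (t, \<mu>) * w K (t, \<mu>)) \<longlongrightarrow> indicator {ml K<..<mr K} \<mu> * w K (z, \<mu>)) (at_left z)"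
      by (rule Lim_transform_eventually[rotated])
    then show ?thesis using 1 by simp
  next
    case 2
    have "\<forall>\<^sub>F t in at_left z. t \<in> {z - 1<..<z}" by (intro eventually_at_leftI[of "z - 1"]) auto
    then have "\<forall>\<^sub>F t in at_left z. indicator (rect_set K) (t, \<mu>) * w K (t, \<mu>) = 0"
      by eventually_elim (use 2 in \<open>auto simp: mem_rect_set indicator_def\<close>)
    then show ?thesis using 2 by (simp add: tendsto_eventually)
  next
    case 3
    have "\<forall>\<^sub>F t in at_left z. t \<in> {zr K<..<z}" using 3 by (intro eventually_at_leftI[of "zr K"]) auto
    then have "\<forall>\<^sub>F t in at_left z. indicator (rect_set K) (t, \<mu>) * w K (t, \<mu>) = 0"
      by eventually_elim (use 3 in \<open>auto simp: mem_rect_set indicator_def\<close>)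
    then show ?thesis using 3 by (simp add: tendsto_eventually)
  qed
qed

lemma tendsto_right_trace:
  assumes "\<forall>K\<in>T. continuous_on UNIV (w K)"
  shows "((\<lambda>t. pw T w (t, \<mu>)) \<longlongrightarrow> right_trace T w z \<mu>) (at_right z)"
  unfolding pw_def right_trace_def
proof (rule tendsto_sum)
  fix K assume K: "K \<in> T"
  have c: "((\<lambda>t. w K (t, \<mu>)) \<longlongrightarrow> w K (z, \<mu>)) (at_right z)"
    using continuous_on_slice(2)[OF assms[rule_format, OF K], of \<mu>]
    by (auto simp: continuous_on_eq_continuous_at intro: isCont_tendsto_compose continuous_within_tendsto_compose
        filterlim_mono[OF _ order_refl at_le] simp: isCont_def)
  consider "zl K \<le> z \<and> z < zr K" | "z < zl K" | "zr K \<le> z" by linarith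
  then show "((\<lambda>t. indicator (rect_set K) (t, \<mu>) * w K (t, \<mu>)) \<longlongrightarrow>
      (if zl K \<le> z \<and> z < zr K then indicator {ml K<..<mr K} \<mu> * w K (z, \<mu>) else 0)) (at_right z)"
  proof cases
    case 1
    have "\<forall>\<^sub>F t in at_right z. t \<in> {z<..<zr K}" using 1 by (intro eventually_at_rightI[of z "zr K"]) auto
    then have "\<forall>\<^sub>F t in at_right z. indicator {ml K<..<mr K} \<mu> * w K (t, \<mu>) = indicator (rect_set K) (t, \<mu>) * w K (t, \<mu>)"
      by eventually_elim (use 1 in \<open>auto simp: mem_rect_set indicator_def\<close>)
    moreover have "((\<lambda>t. indicator {ml K<..<mr K} \<mu> * w K (t, \<mu>)) \<longlongrightarrow> indicator {ml K<..<mr K} \<mu> * w K (z, \<mu>)) (at_right z)"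
      by (intro tendsto_intros c)
    ultimately have "((\<lambda>t. indicator (rect_set K) (t, \<mu>) * w K (t, \<mu>)) \<longlongrightarrow> indicator {ml K<..<mr K} \<mu> * w K (z, \<mu>)) (at_right z)"
      by (rule Lim_transform_eventually[rotated])
    then show ?thesis using 1 by simp
  next
    case 2
    have "\<forall>\<^sub>F t in at_right z. t \<in> {z<..<zl K}" using 2 by (intro eventually_at_rightI[of z "zl K"]) auto
    then have "\<forall>\<^sub>F t in at_right z. indicator (rect_set K) (t, \<mu>) * w K (t, \<mu>) = 0"
      by eventually_elim (use 2 in \<open>auto simp: mem_rect_set indicator_def\<close>)
    then show ?thesis using 2 by (simp add: tendsto_eventually)
  next
    case 3
    have "\<forall>\<^sub>F t in at_right z. t \<in> {z<..<z + 1}" by (intro eventually_at_rightI[of z "z + 1"]) auto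
    then have "\<forall>\<^sub>F t in at_right z. indicator (rect_set K) (t, \<mu>) * w K (t, \<mu>) = 0"
      by eventually_elim (use 3 in \<open>auto simp: mem_rect_set indicator_def\<close>)
    then show ?thesis using 3 by (simp add: tendsto_eventually)
  qed
qed

text \<open>On the vertical grid lines u may jump and \<open>deriv\<close> is uninformative. Off
  them, every summand of u agrees near z either with a differentiable piece or with 0.\<close>

lemma dzh_pw:
  assumes "represents T u w w'" "z \<notin> zl ` T" "z \<notin> zr ` T"
  shows "dzh u (z, \<mu>) = pw T w' (z, \<mu>)"
proof -
  have "((\<lambda>t. indicator (rect_set K) (t, \<mu>) * w K (t, \<mu>)) has_real_derivative
      indicator (rect_set K) (z, \<mu>) * w' K (z, \<mu>)) (at z)" if K: "K \<in> T" for K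
  proof (cases "z \<in> {zl K<..<zr K}")
    case True
    have "((\<lambda>t. indicator {ml K<..<mr K} \<mu> * w K (t, \<mu>)) has_real_derivative
        indicator {ml K<..<mr K} \<mu> * w' K (z, \<mu>)) (at z)"
      using assms(1) K unfolding represents_def by (intro DERIV_cmult) auto
    then have "((\<lambda>t. indicator (rect_set K) (t, \<mu>) * w K (t, \<mu>)) has_real_derivative
        indicator {ml K<..<mr K} \<mu> * w' K (z, \<mu>)) (at z)"
      by (rule has_field_derivative_transform_within_open[of _ _ _ "{zl K<..<zr K}"])
         (use True in \<open>auto simp: indicator_def mem_rect_set\<close>)
    then show ?thesis using True by (auto simp: indicator_def mem_rect_set)
  next
    case False
    then have z: "z \<in> - {zl K..zr K}" using assms(2,3) K by fastforce
    have "((\<lambda>t. indicator (rect_set K) (t, \<mu>) * w K (t, \<mu>)) has_real_derivative 0) (at z)"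
      by (rule has_field_derivative_transform_within_open[of "\<lambda>_. 0" _ _ "- {zl K..zr K}"])
         (use z in \<open>auto simp: indicator_def mem_rect_set\<close>)
    then show ?thesis using z by (auto simp: indicator_def mem_rect_set)
  qed
  then have "((\<lambda>t. pw T w (t, \<mu>)) has_real_derivative pw T w' (z, \<mu>)) (at z)"
    unfolding pw_def by (rule DERIV_sum)
  then show ?thesis using assms(1) by (simp add: dzh_def represents_def DERIV_imp_deriv)
qed

text \<open>The point z may itself belong to Z, since the filter ignores it. This is the situation
  at a face, which lies on a grid line.\<close>

lemma eventually_not_in_finite:
  fixes z :: "'a::t1_space"
  assumes "finite Z"
  shows "\<forall>\<^sub>F t in at z within S. t \<notin> Z"
proof -
  have "open (- (Z - {z}))" using assms by (intro open_Compl finite_imp_closed) auto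
  then show ?thesis unfolding eventually_at_topological by (intro exI[of _ "- (Z - {z})"]) auto
qed

lemma vface_in:
  assumes "F \<in> vfaces T"
  shows "fst F \<in> T" "snd F \<in> T" "zr (fst F) = zl (snd F)"
  using assms by (auto simp: vfaces_def)

lemma vface_mu:
  assumes "\<mu> \<in> {mbF F<..<mtF F}"
  shows "\<mu> \<in> {ml (fst F)<..<mr (fst F)}" "\<mu> \<in> {ml (snd F)<..<mr (snd F)}"
  using assms by (auto simp: mbF_def mtF_def)

section \<open>Mesh geometry and one-sided traces on faces\<close>

locale dg_mesh =
  fixes L :: real and \<sigma>t :: "real \<Rightarrow> real" and T :: "rect set"
  assumes L_pos: "L > 0" and mesh: "is_mesh L T"
    and \<sigma>t_const: "\<forall>K\<in>T. \<exists>s. \<forall>z\<in>{zl K<..<zr K}. \<sigma>t z = s"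
begin

lemma finite_T: "finite T"
  and zl_less_zr: "K \<in> T \<Longrightarrow> zl K < zr K"
  and ml_less_mr: "K \<in> T \<Longrightarrow> ml K < mr K"
  and rect_sub: "K \<in> T \<Longrightarrow> rect_set K \<subseteq> Omega L"
  and rect_disj: "K \<in> T \<Longrightarrow> K' \<in> T \<Longrightarrow> p \<in> rect_set K \<Longrightarrow> p \<in> rect_set K' \<Longrightarrow> K = K'"
  using mesh unfolding is_mesh_def by blast+

lemma finite_vfaces: "finite (vfaces T)"
  by (rule finite_subset[of _ "T \<times> T"]) (auto simp: vfaces_def finite_T)

lemma \<sigma>t_eq: "K \<in> T \<Longrightarrow> z \<in> {zl K<..<zr K} \<Longrightarrow> \<sigma>t z = sigK \<sigma>t K"
  using \<sigma>t_const[rule_format, of K] zl_less_zr[of K] by (auto simp: sigK_def)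

lemma pw_eq: "K \<in> T \<Longrightarrow> p \<in> rect_set K \<Longrightarrow> pw T w p = w K p"
proof -
  assume K: "K \<in> T" "p \<in> rect_set K"
  have "pw T w p = (\<Sum>K'\<in>T. if K' = K then w K p else 0)"
    unfolding pw_def
  proof (rule sum.cong[OF refl])
    fix K' assume "K' \<in> T"
    then show "indicator (rect_set K') p * w K' p = (if K' = K then w K p else 0)"
      using K rect_disj[of K' K p] by (cases "K' = K"; cases "p \<in> rect_set K'") auto
  qed
  then show ?thesis using K finite_T by simp
qed

lemma pw_zero: "(\<And>K. K \<in> T \<Longrightarrow> p \<notin> rect_set K) \<Longrightarrow> pw T w p = 0"
  by (simp add: pw_def)

lemma pw_mult: "pw T f p * pw T g p = pw T (\<lambda>K p. f K p * g K p) p"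
  by (cases "\<exists>K\<in>T. p \<in> rect_set K") (auto simp: pw_eq pw_zero)

lemma integral_pw:
  assumes "\<forall>K\<in>T. continuous_on UNIV (f K)"
  shows "(LINT p|lebesgue_on (Omega L). pw T f p) = (\<Sum>K\<in>T. LINT p|lebesgue_on (rect_set K). f K p)"
proof -
  have "(LINT p|lebesgue_on (Omega L). pw T f p) =
      (\<Sum>K\<in>T. LINT p|lebesgue_on (Omega L). indicator (rect_set K) p * f K p)"
    unfolding pw_def
    using assms open_Omega bounded_Omega open_rect_set bounded_rect_set
    by (intro Bochner_Integration.integral_sum bdd_borel_integrable bdd_borel_indicator_continuous) auto
  also have "\<dots> = (\<Sum>K\<in>T. LINT p|lebesgue_on (rect_set K). f K p)"
  proof (rule sum.cong[OF refl])
    fix K assume K: "K \<in> T"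
    have "(LINT p|lebesgue_on (Omega L). indicator (rect_set K) p * f K p) =
        (LINT p|lebesgue. indicator (Omega L) p *\<^sub>R (indicator (rect_set K) p * f K p))"
      using open_Omega by (intro integral_restrict_space) auto
    also have "\<dots> = (LINT p|lebesgue. indicator (rect_set K) p *\<^sub>R f K p)"
      using rect_sub[OF K] by (intro Bochner_Integration.integral_cong) (auto simp: indicator_def)
    also have "\<dots> = (LINT p|lebesgue_on (rect_set K). f K p)"
      using open_rect_set by (intro integral_restrict_space[symmetric]) auto
    finally show "(LINT p|lebesgue_on (Omega L). indicator (rect_set K) p * f K p) =
        (LINT p|lebesgue_on (rect_set K). f K p)" .
  qed
  finally show ?thesis .
qed

lemma left_trace_face:
  assumes F: "F \<in> vfaces T" and \<mu>: "\<mu> \<in> {mbF F<..<mtF F}"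
  shows "left_trace T w (zF F) \<mu> = w (fst F) (zF F, \<mu>)"
proof -
  have "left_trace T w (zF F) \<mu> = (\<Sum>K\<in>T. if K = fst F then w (fst F) (zF F, \<mu>) else 0)"
    unfolding left_trace_def
  proof (rule sum.cong[OF refl])
    fix K assume K: "K \<in> T"
    show "(if zl K < zF F \<and> zF F \<le> zr K then indicator {ml K<..<mr K} \<mu> * w K (zF F, \<mu>) else 0) =
       (if K = fst F then w (fst F) (zF F, \<mu>) else 0)"
    proof (cases "K = fst F")
      case True
      then show ?thesis using zl_less_zr[OF K] vface_mu(1)[OF \<mu>] by (auto simp: zF_def)
    next
      case False
      have False if "zl K < zF F" "zF F \<le> zr K" "\<mu> \<in> {ml K<..<mr K}"
      proof -
        \<comment> \<open>A point slightly left of the face and to the right of both left edges; a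
          second element touching the face from the left at this height would share it with
          \<open>fst F\<close>.\<close>
        let ?p = "((max (zl K) (zl (fst F)) + zF F) / 2, \<mu>)"
        have "?p \<in> rect_set K" "?p \<in> rect_set (fst F)"
          using that zl_less_zr[OF vface_in(1)[OF F]] vface_mu(1)[OF \<mu>] by (auto simp: mem_rect_set zF_def)
        then show False using rect_disj[OF K vface_in(1)[OF F]] False by blast
      qed
      then show ?thesis using False by (auto simp: indicator_def)
    qed
  qed
  then show ?thesis using finite_T vface_in(1)[OF F] by simp
qed

lemma right_trace_face:
  assumes F: "F \<in> vfaces T" and \<mu>: "\<mu> \<in> {mbF F<..<mtF F}"
  shows "right_trace T w (zF F) \<mu> = w (snd F) (zF F, \<mu>)"
proof -
  have "right_trace T w (zF F) \<mu> = (\<Sum>K\<in>T. if K = snd F then w (snd F) (zF F, \<mu>) else 0)"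
    unfolding right_trace_def
  proof (rule sum.cong[OF refl])
    fix K assume K: "K \<in> T"
    show "(if zl K \<le> zF F \<and> zF F < zr K then indicator {ml K<..<mr K} \<mu> * w K (zF F, \<mu>) else 0) =
       (if K = snd F then w (snd F) (zF F, \<mu>) else 0)"
    proof (cases "K = snd F")
      case True
      then show ?thesis using zl_less_zr[OF K] vface_mu(2)[OF \<mu>] vface_in(3)[OF F] by (auto simp: zF_def)
    next
      case False
      have False if "zl K \<le> zF F" "zF F < zr K" "\<mu> \<in> {ml K<..<mr K}"
      proof -
        let ?p = "((min (zr K) (zr (snd F)) + zF F) / 2, \<mu>)"
        have "?p \<in> rect_set K" "?p \<in> rect_set (snd F)"
          using that zl_less_zr[OF vface_in(2)[OF F]] vface_mu(2)[OF \<mu>] vface_in(3)[OF F]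
          by (auto simp: mem_rect_set zF_def)
        then show False using rect_disj[OF K vface_in(2)[OF F]] False by blast
      qed
      then show ?thesis using False by (auto simp: indicator_def)
    qed
  qed
  then show ?thesis using finite_T vface_in(2)[OF F] by simp
qed

lemma jump_eq:
  assumes "represents T u w w'" "F \<in> vfaces T" "\<mu> \<in> {mbF F<..<mtF F}"
  shows "jump F u \<mu> = w (fst F) (zF F, \<mu>) - w (snd F) (zF F, \<mu>)"
proof -
  have c: "\<forall>K\<in>T. continuous_on UNIV (w K)" and u: "u = pw T w" using assms by (auto simp: represents_def)
  show ?thesis unfolding jump_def u
    using tendsto_Lim[OF _ tendsto_left_trace[OF c, of \<mu> "zF F"]] tendsto_Lim[OF _ tendsto_right_trace[OF c, of \<mu> "zF F"]]
    by (simp add: left_trace_face right_trace_face assms(2) assms(3)[simplified])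
qed

text \<open>Near the face, a one-sided limit stays inside the adjacent element and off the grid
  lines; there \<sigma>t is the constant of that element and \<open>dzh u\<close> is given by the
  extended derivatives.\<close>

lemma avg_flux_eq:
  assumes u: "represents T u w w'" and F: "F \<in> vfaces T" and \<mu>: "\<mu> \<in> {mbF F<..<mtF F}"
  shows "avg F (flux \<sigma>t u) \<mu> = (\<mu> / sigK \<sigma>t (fst F) * w' (fst F) (zF F, \<mu>) +
     \<mu> / sigK \<sigma>t (snd F) * w' (snd F) (zF F, \<mu>)) / 2"
proof -
  have c: "\<forall>K\<in>T. continuous_on UNIV (w' K)" using assms by (auto simp: represents_def)
  have nZ: "\<forall>\<^sub>F t in at (zF F) within S. t \<notin> zl ` T \<union> zr ` T" for S
    using finite_T by (intro eventually_not_in_finite) auto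
  have "\<forall>\<^sub>F t in at_left (zF F). t \<in> {zl (fst F)<..<zF F}"
    using zl_less_zr[OF vface_in(1)[OF F]] by (intro eventually_at_leftI[of "zl (fst F)"]) (auto simp: zF_def)
  with nZ[of "{..<zF F}"] have ev1: "\<forall>\<^sub>F t in at_left (zF F). \<mu> / sigK \<sigma>t (fst F) * pw T w' (t, \<mu>) = flux \<sigma>t u (t, \<mu>)"
    by eventually_elim (use \<sigma>t_eq[OF vface_in(1)[OF F]] dzh_pw[OF u] in \<open>auto simp: flux_def zF_def\<close>)
  have "((\<lambda>t. \<mu> / sigK \<sigma>t (fst F) * pw T w' (t, \<mu>)) \<longlongrightarrow> \<mu> / sigK \<sigma>t (fst F) * w' (fst F) (zF F, \<mu>)) (at_left (zF F))"
    using tendsto_left_trace[OF c, of \<mu> "zF F"] left_trace_face[OF F \<mu>] by (intro tendsto_mult_left) auto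
  from Lim_transform_eventually[OF this ev1]
  have 1: "Lim (at_left (zF F)) (\<lambda>t. flux \<sigma>t u (t, \<mu>)) = \<mu> / sigK \<sigma>t (fst F) * w' (fst F) (zF F, \<mu>)"
    by (intro tendsto_Lim) auto
  have "\<forall>\<^sub>F t in at_right (zF F). t \<in> {zF F<..<zr (snd F)}"
    using zl_less_zr[OF vface_in(2)[OF F]] vface_in(3)[OF F]
    by (intro eventually_at_rightI[of _ "zr (snd F)"]) (auto simp: zF_def)
  with nZ[of "{zF F<..}"] have ev2: "\<forall>\<^sub>F t in at_right (zF F). \<mu> / sigK \<sigma>t (snd F) * pw T w' (t, \<mu>) = flux \<sigma>t u (t, \<mu>)"
    by eventually_elim (use \<sigma>t_eq[OF vface_in(2)[OF F]] dzh_pw[OF u] vface_in(3)[OF F] in \<open>auto simp: flux_def zF_def\<close>)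
  have "((\<lambda>t. \<mu> / sigK \<sigma>t (snd F) * pw T w' (t, \<mu>)) \<longlongrightarrow> \<mu> / sigK \<sigma>t (snd F) * w' (snd F) (zF F, \<mu>)) (at_right (zF F))"
    using tendsto_right_trace[OF c, of \<mu> "zF F"] right_trace_face[OF F \<mu>] by (intro tendsto_mult_left) auto
  from Lim_transform_eventually[OF this ev2]
  have 2: "Lim (at_right (zF F)) (\<lambda>t. flux \<sigma>t u (t, \<mu>)) = \<mu> / sigK \<sigma>t (snd F) * w' (snd F) (zF F, \<mu>)"
    by (intro tendsto_Lim) auto
  show ?thesis unfolding avg_def 1 2 ..
qed

lemma trace_h_eq:
  assumes "represents T u w w'"
  shows "trace_h L u (0, \<mu>) = right_trace T w 0 \<mu>" "trace_h L u (L, \<mu>) = left_trace T w L \<mu>"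
proof -
  have c: "\<forall>K\<in>T. continuous_on UNIV (w K)" and u: "u = pw T w" using assms by (auto simp: represents_def)
  show "trace_h L u (0, \<mu>) = right_trace T w 0 \<mu>" "trace_h L u (L, \<mu>) = left_trace T w L \<mu>"
    using L_pos tendsto_Lim[OF _ tendsto_left_trace[OF c, of \<mu> L]] tendsto_Lim[OF _ tendsto_right_trace[OF c, of \<mu> 0]]
    by (auto simp: trace_h_def u)
qed

end

section \<open>Bilinearity and symmetry\<close>

text \<open>Completeness of Lebesgue measure. It spares separate measurability proofs for integrands
  that contain \<sigma>t, \<sigma>s or \<open>deriv\<close>.\<close>

lemma lebesgue_on_measurable_AE:
  fixes f g :: "'a::euclidean_space \<Rightarrow> real"
  assumes S: "S \<in> sets borel" and g: "g \<in> borel_measurable (lebesgue_on S)"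
    and ae: "AE x in lebesgue_on S. f x = g x"
  shows "f \<in> borel_measurable (lebesgue_on S)"
proof -
  let ?f = "\<lambda>x. if x \<in> S then f x else 0" and ?g = "\<lambda>x. if x \<in> S then g x else 0"
  have SL: "S \<in> sets lebesgue" using S by auto
  have g': "?g \<in> borel_measurable lebesgue" using g by (simp only: borel_measurable_if[OF SL])
  have "AE x in lebesgue. x \<in> S \<longrightarrow> f x = g x" using ae SL by (simp add: AE_restrict_space_iff)
  then have eq: "AE x in lebesgue. ?f x = ?g x" by eventually_elim auto
  have "?f \<in> borel_measurable lebesgue"
  proof (rule measurableI)
    fix A :: "real set" assume A: "A \<in> sets borel"
    have "?g -` A \<inter> space lebesgue \<in> sets lebesgue" using g' A by (rule measurable_sets)
    then show "?f -` A \<inter> space lebesgue \<in> sets lebesgue"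
      by (rule completion.in_sets_AE[rotated]) (use eq in \<open>auto elim: eventually_mono\<close>)
  qed simp
  then show ?thesis by (simp only: borel_measurable_if[OF SL])
qed

lemma lebesgue_on_integral_cong_AE:
  fixes f g :: "'a::euclidean_space \<Rightarrow> real"
  assumes "S \<in> sets borel" "g \<in> borel_measurable (lebesgue_on S)" "AE x in lebesgue_on S. f x = g x"
  shows "integral\<^sup>L (lebesgue_on S) f = integral\<^sup>L (lebesgue_on S) g"
  using assms by (intro integral_cong_AE lebesgue_on_measurable_AE[OF assms])

lemma integral_lin:
  fixes f g h :: "'a \<Rightarrow> real"
  assumes "integrable M f" "integrable M g" "\<And>x. x \<in> space M \<Longrightarrow> h x = f x + s * g x"
  shows "integral\<^sup>L M h = integral\<^sup>L M f + s * integral\<^sup>L M g"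
proof -
  have "integral\<^sup>L M h = (LINT x|M. f x + s * g x)"
    using assms(3) by (intro Bochner_Integration.integral_cong) auto
  then show ?thesis using assms by simp
qed

lemma left_trace_lin: "left_trace T (\<lambda>K p. w K p + s * x K p) z \<mu> = left_trace T w z \<mu> + s * left_trace T x z \<mu>"
  unfolding left_trace_def sum_distrib_left sum.distrib[symmetric]
  by (intro sum.cong) (auto simp: algebra_simps)

lemma right_trace_lin: "right_trace T (\<lambda>K p. w K p + s * x K p) z \<mu> = right_trace T w z \<mu> + s * right_trace T x z \<mu>"
  unfolding right_trace_def sum_distrib_left sum.distrib[symmetric]
  by (intro sum.cong) (auto simp: algebra_simps)

text \<open>\<open>Pop u\<close> regarded as a function of z alone, the form in which it meets
  Fubini.\<close>

definition slice_mean :: "(real \<times> real \<Rightarrow> real) \<Rightarrow> real \<Rightarrow> real" where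
  "slice_mean u z = (LINT \<mu>|lebesgue_on {0<..<1}. u (z, \<mu>))"

lemma Pop_eq: "Pop u p = slice_mean u (fst p)"
  by (cases p) (simp add: Pop_def slice_mean_def)

lemma bdd_borel_slice_mean: "bdd_borel u \<Longrightarrow> bdd_borel (slice_mean u)"
  unfolding slice_mean_def[abs_def] by (intro bdd_borel_slice_integral) auto

lemma slice_mean_lin:
  assumes "bdd_borel u" "bdd_borel v"
  shows "slice_mean (\<lambda>p. u p + s * v p) z = slice_mean u z + s * slice_mean v z"
  unfolding slice_mean_def
  by (intro integral_lin bdd_borel_integrable bdd_borel_slice assms) auto

lemma represents_bdd_borel: "represents T u w w' \<Longrightarrow> bdd_borel u"
  by (simp add: represents_def bdd_borel_pw)

text \<open>\<rho> is the bounded, nonnegative Borel version of \<sigma>s. The absorption bound is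
  stated for \<rho>, so that \<sigma>s enters only through \<open>a_h\<close> and
  \<open>\<rho>_eq\<close>.\<close>

locale dg_problem = dg_mesh L \<sigma>t T
  for L :: real and \<sigma>t :: "real \<Rightarrow> real" and T :: "rect set" +
  fixes \<sigma>s \<rho> :: "real \<Rightarrow> real" and c :: real and \<alpha> :: "rect \<times> rect \<Rightarrow> real"
  assumes \<rho>_bdd: "bdd_borel \<rho>" and \<rho>_nonneg: "\<And>z. \<rho> z \<ge> 0"
    and \<rho>_eq: "AE z in lebesgue_on {0<..<L}. \<sigma>s z = \<rho> z"
    and c_pos: "c > 0" and absorb: "AE z in lebesgue_on {0<..<L}. \<sigma>t z - \<rho> z \<ge> c"
begin

text \<open>This and the following forms are the terms of \<open>a_h\<close> expressed in the
  extended pieces. \<open>grad_form\<close> and the first argument of \<open>flux_form\<close>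
  expect the derivative pieces; \<open>scatter_form\<close> keeps the functions themselves, because
  averaging over \<mu> mixes elements.\<close>

definition grad_form :: "(rect \<Rightarrow> real \<times> real \<Rightarrow> real) \<Rightarrow> (rect \<Rightarrow> real \<times> real \<Rightarrow> real) \<Rightarrow> real" where
  "grad_form w x = (\<Sum>K\<in>T. inverse (sigK \<sigma>t K) * (LINT p|lebesgue_on (rect_set K). (snd p)\<^sup>2 * (w K p * x K p)))"

definition mass_form :: "(rect \<Rightarrow> real \<times> real \<Rightarrow> real) \<Rightarrow> (rect \<Rightarrow> real \<times> real \<Rightarrow> real) \<Rightarrow> real" where
  "mass_form w x = (\<Sum>K\<in>T. sigK \<sigma>t K * (LINT p|lebesgue_on (rect_set K). w K p * x K p))"

definition scatter_form where
  "scatter_form u v = (LINT z|lebesgue_on {0<..<L}. \<rho> z * (slice_mean u z * slice_mean v z))"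

definition bdry_form :: "(rect \<Rightarrow> real \<times> real \<Rightarrow> real) \<Rightarrow> (rect \<Rightarrow> real \<times> real \<Rightarrow> real) \<Rightarrow> real" where
  "bdry_form w x = (LINT \<mu>|lebesgue_on {0<..<1}.
     (left_trace T w L \<mu> * left_trace T x L \<mu> + right_trace T w 0 \<mu> * right_trace T x 0 \<mu>) * \<mu>)"

definition face_jump :: "rect \<times> rect \<Rightarrow> (rect \<Rightarrow> real \<times> real \<Rightarrow> real) \<Rightarrow> real \<Rightarrow> real" where
  "face_jump F w \<mu> = w (fst F) (zF F, \<mu>) - w (snd F) (zF F, \<mu>)"

definition face_avg :: "rect \<times> rect \<Rightarrow> (rect \<Rightarrow> real \<times> real \<Rightarrow> real) \<Rightarrow> real \<Rightarrow> real" where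
  "face_avg F w' \<mu> = (\<mu> / sigK \<sigma>t (fst F) * w' (fst F) (zF F, \<mu>) +
     \<mu> / sigK \<sigma>t (snd F) * w' (snd F) (zF F, \<mu>)) / 2"

definition flux_form :: "rect \<times> rect \<Rightarrow> (rect \<Rightarrow> real \<times> real \<Rightarrow> real) \<Rightarrow> (rect \<Rightarrow> real \<times> real \<Rightarrow> real) \<Rightarrow> real" where
  "flux_form F w' x = (LINT \<mu>|lebesgue_on {mbF F<..<mtF F}. face_avg F w' \<mu> * face_jump F x \<mu> * \<mu>)"

definition jump_form :: "rect \<times> rect \<Rightarrow> (rect \<Rightarrow> real \<times> real \<Rightarrow> real) \<Rightarrow> (rect \<Rightarrow> real \<times> real \<Rightarrow> real) \<Rightarrow> real" where
  "jump_form F w x = (LINT \<mu>|lebesgue_on {mbF F<..<mtF F}. face_jump F w \<mu> * face_jump F x \<mu> * \<mu>)"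

lemma AE_off_grid: "AE p in lebesgue_on (Omega L). fst p \<notin> zl ` T \<union> zr ` T"
  unfolding Omega_def using finite_T
  by (intro AE_lebesgue_on_fst AE_lebesgue_on_finite) auto

lemma ip_grad:
  assumes u: "represents T u w w'" and v: "represents T v x x'"
  shows "ip L (\<lambda>(z,\<mu>). inverse (\<sigma>t z) * (\<mu> * dzh u (z,\<mu>))) (\<lambda>(z,\<mu>). \<mu> * dzh v (z,\<mu>)) = grad_form w' x'"
proof -
  let ?f = "\<lambda>K p. inverse (sigK \<sigma>t K) * ((snd p)\<^sup>2 * (w' K p * x' K p))"
  have c: "\<forall>K\<in>T. continuous_on UNIV (?f K)"
    using u v unfolding represents_def by (auto intro!: continuous_intros)
  have "ip L (\<lambda>(z,\<mu>). inverse (\<sigma>t z) * (\<mu> * dzh u (z,\<mu>))) (\<lambda>(z,\<mu>). \<mu> * dzh v (z,\<mu>))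
     = (LINT p|lebesgue_on (Omega L). pw T ?f p)"
    unfolding ip_def
  proof (rule lebesgue_on_integral_cong_AE)
    show "pw T ?f \<in> borel_measurable (lebesgue_on (Omega L))"
      by (intro measurable_lebesgue_on_borel bdd_borel_measurable bdd_borel_pw c)
    show "AE p in lebesgue_on (Omega L). (case p of (z, \<mu>) \<Rightarrow> inverse (\<sigma>t z) * (\<mu> * dzh u (z, \<mu>))) *
         (case p of (z, \<mu>) \<Rightarrow> \<mu> * dzh v (z, \<mu>)) = pw T ?f p"
      using AE_off_grid
    proof eventually_elim
      fix p :: "real \<times> real" assume *: "fst p \<notin> zl ` T \<union> zr ` T"
      obtain z \<mu> where p: "p = (z, \<mu>)" by (cases p)
      have d: "dzh u (z, \<mu>) = pw T w' (z, \<mu>)" "dzh v (z, \<mu>) = pw T x' (z, \<mu>)"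
        using * p dzh_pw[OF u] dzh_pw[OF v] by auto
      show "(case p of (z, \<mu>) \<Rightarrow> inverse (\<sigma>t z) * (\<mu> * dzh u (z, \<mu>))) *
         (case p of (z, \<mu>) \<Rightarrow> \<mu> * dzh v (z, \<mu>)) = pw T ?f p"
      proof (cases "\<exists>K\<in>T. p \<in> rect_set K")
        case True
        then obtain K where K: "K \<in> T" "p \<in> rect_set K" by blast
        then have "\<sigma>t z = sigK \<sigma>t K" using \<sigma>t_eq[OF K(1)] by (auto simp: p mem_rect_set)
        then show ?thesis using pw_eq[OF K] by (simp add: p d power2_eq_square)
      next
        case False
        then show ?thesis by (simp add: p d pw_zero)
      qed
    qed
  qed (use open_Omega in auto)
  also have "\<dots> = grad_form w' x'"
    unfolding grad_form_def integral_pw[OF c] by simp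
  finally show ?thesis .
qed

lemma ip_mass:
  assumes u: "represents T u w w'" and v: "represents T v x x'"
  shows "ip L (\<lambda>(z,\<mu>). \<sigma>t z * u (z,\<mu>)) v = mass_form w x"
proof -
  let ?f = "\<lambda>K p. sigK \<sigma>t K * (w K p * x K p)"
  have c: "\<forall>K\<in>T. continuous_on UNIV (?f K)"
    using u v unfolding represents_def by (auto intro!: continuous_intros)
  have uv: "u = pw T w" "v = pw T x" using u v by (auto simp: represents_def)
  have "(case p of (z, \<mu>) \<Rightarrow> \<sigma>t z * u (z,\<mu>)) * v p = pw T ?f p" for p
  proof (cases "\<exists>K\<in>T. p \<in> rect_set K")
    case True
    then obtain K where K: "K \<in> T" "p \<in> rect_set K" by blast
    obtain z \<mu> where p: "p = (z, \<mu>)" by (cases p)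
    have "\<sigma>t z = sigK \<sigma>t K" using \<sigma>t_eq[OF K(1)] K by (auto simp: p mem_rect_set)
    then show ?thesis using pw_eq[OF K] by (simp add: p uv)
  next
    case False
    then show ?thesis by (cases p) (simp add: pw_zero uv)
  qed
  then have "ip L (\<lambda>(z,\<mu>). \<sigma>t z * u (z,\<mu>)) v = (LINT p|lebesgue_on (Omega L). pw T ?f p)"
    by (simp add: ip_def)
  also have "\<dots> = mass_form w x" unfolding mass_form_def integral_pw[OF c] by simp
  finally show ?thesis .
qed

lemma Fubini_Omega:
  assumes "bdd_borel f"
  shows "(LINT p|lebesgue_on (Omega L). f p) = (LINT z|lebesgue_on {0<..<L}. LINT \<mu>|lebesgue_on {0<..<1}. f (z, \<mu>))"
  unfolding Omega_def by (intro Fubini_rectangle(1) assms) auto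

text \<open>\<open>Pop u\<close> does not depend on \<mu>, so integrating over \<mu> first turns v
  into its mean as well. The scattering term becomes visibly symmetric and depends on the means
  only.\<close>

lemma ip_scatter:
  assumes u: "represents T u w w'" and v: "represents T v x x'"
  shows "ip L (\<lambda>(z,\<mu>). \<sigma>s z * Pop u (z,\<mu>)) v = scatter_form u v"
proof -
  note b = represents_bdd_borel[OF u] represents_bdd_borel[OF v]
  let ?g = "\<lambda>p. (\<rho> (fst p) * slice_mean u (fst p)) * v p"
  have bg: "bdd_borel ?g"
    by (intro bdd_borel_mult bdd_borel_fst[of "\<lambda>z. \<rho> z * slice_mean u z"] \<rho>_bdd bdd_borel_slice_mean b)
  have "AE p in lebesgue_on (Omega L). \<sigma>s (fst p) = \<rho> (fst p)"
    unfolding Omega_def using \<rho>_eq by (rule AE_lebesgue_on_fst) auto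
  then have "AE p in lebesgue_on (Omega L). (case p of (z,\<mu>) \<Rightarrow> \<sigma>s z * Pop u (z,\<mu>)) * v p = ?g p"
    by eventually_elim (auto simp: Pop_eq)
  then have "ip L (\<lambda>(z,\<mu>). \<sigma>s z * Pop u (z,\<mu>)) v = (LINT p|lebesgue_on (Omega L). ?g p)"
    unfolding ip_def using open_Omega
    by (intro lebesgue_on_integral_cong_AE measurable_lebesgue_on_borel bdd_borel_measurable bg) auto
  also have "\<dots> = scatter_form u v"
    unfolding Fubini_Omega[OF bg] scatter_form_def slice_mean_def[of v] by (simp add: mult.assoc)
  finally show ?thesis .
qed

lemma bip_bdry:
  assumes u: "represents T u w w'" and v: "represents T v x x'"
  shows "bip L (trace_h L u) (trace_h L v) = bdry_form w x"
  unfolding bip_def bdry_form_def trace_h_eq[OF u] trace_h_eq[OF v] ..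

lemma continuous_face:
  assumes "F \<in> vfaces T" "\<forall>K\<in>T. continuous_on UNIV (w K)"
  shows "continuous_on UNIV (face_jump F w)" "continuous_on UNIV (face_avg F w)"
  using assms vface_in[OF assms(1)] unfolding face_jump_def[abs_def] face_avg_def[abs_def] divide_inverse
  by (auto intro!: continuous_intros continuous_on_slice)

lemma integrable_face:
  "continuous_on UNIV (f :: real \<Rightarrow> real) \<Longrightarrow> integrable (lebesgue_on {mbF F<..<mtF F}) f"
  by (intro continuous_integrable_bounded) auto

lemma face_int_flux:
  assumes u: "represents T u w w'" and v: "represents T v x x'" and F: "F \<in> vfaces T"
  shows "face_int F (\<lambda>\<mu>. avg F (flux \<sigma>t u) \<mu> * jump F v \<mu> + avg F (flux \<sigma>t v) \<mu> * jump F u \<mu>)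
    = flux_form F w' x + flux_form F x' w"
proof -
  have "face_int F (\<lambda>\<mu>. avg F (flux \<sigma>t u) \<mu> * jump F v \<mu> + avg F (flux \<sigma>t v) \<mu> * jump F u \<mu>) =
    (LINT \<mu>|lebesgue_on {mbF F<..<mtF F}. face_avg F w' \<mu> * face_jump F x \<mu> * \<mu> + face_avg F x' \<mu> * face_jump F w \<mu> * \<mu>)"
    unfolding face_int_def
    by (intro Bochner_Integration.integral_cong refl)
       (simp add: avg_flux_eq[OF u F] avg_flux_eq[OF v F] jump_eq[OF u F] jump_eq[OF v F] face_jump_def face_avg_def
          algebra_simps)
  also have "\<dots> = flux_form F w' x + flux_form F x' w"
    unfolding flux_form_def using u v
    by (intro Bochner_Integration.integral_add integrable_face continuous_intros continuous_face F)
       (auto simp: represents_def)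
  finally show ?thesis .
qed

lemma face_int_jump:
  assumes u: "represents T u w w'" and v: "represents T v x x'" and F: "F \<in> vfaces T"
  shows "face_int F (\<lambda>\<mu>. jump F u \<mu> * jump F v \<mu>) = jump_form F w x"
  unfolding face_int_def jump_form_def
  by (intro Bochner_Integration.integral_cong refl)
     (simp add: jump_eq[OF u F] jump_eq[OF v F] face_jump_def)

lemma a_h_eq:
  assumes u: "represents T u w w'" and v: "represents T v x x'"
  shows "a_h L \<sigma>s \<sigma>t T \<alpha> u v = grad_form w' x' + mass_form w x - scatter_form u v + bdry_form w x
     - (\<Sum>F\<in>vfaces T. flux_form F w' x + flux_form F x' w)
     + (\<Sum>F\<in>vfaces T. \<alpha> F / DF \<sigma>t F * jump_form F w x)"
  unfolding a_h_def a_he_def ip_grad[OF u v] ip_mass[OF u v] ip_scatter[OF u v] bip_bdry[OF u v]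
  using face_int_flux[OF u v] face_int_jump[OF u v] by simp

text \<open>Symmetry transfers linearity in the first argument, proved in \<open>a_h_lin\<close>, to
  the second.\<close>

lemma a_h_commute:
  assumes u: "represents T u w w'" and v: "represents T v x x'"
  shows "a_h L \<sigma>s \<sigma>t T \<alpha> u v = a_h L \<sigma>s \<sigma>t T \<alpha> v u"
  unfolding a_h_eq[OF u v] a_h_eq[OF v u] grad_form_def mass_form_def scatter_form_def bdry_form_def jump_form_def
  by (simp add: mult.commute add.commute)

lemma integrable_rect:
  "continuous_on UNIV (f :: real \<times> real \<Rightarrow> real) \<Longrightarrow> integrable (lebesgue_on (rect_set K)) f"
  using open_rect_set bounded_rect_set by (intro continuous_integrable_bounded) auto

lemma a_h_lin:
  assumes u: "represents T u w w'" and v: "represents T v x x'" and y: "represents T y q q'"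
  shows "a_h L \<sigma>s \<sigma>t T \<alpha> (\<lambda>p. u p + s * v p) y = a_h L \<sigma>s \<sigma>t T \<alpha> u y + s * a_h L \<sigma>s \<sigma>t T \<alpha> v y"
proof -
  let ?w = "\<lambda>K p. w K p + s * x K p" and ?w' = "\<lambda>K p. w' K p + s * x' K p" and ?u = "\<lambda>p. u p + s * v p"
  note uv = represents_lin[OF u v, of s]
  have c: "\<forall>K\<in>T. continuous_on UNIV (w K)" "\<forall>K\<in>T. continuous_on UNIV (w' K)"
    "\<forall>K\<in>T. continuous_on UNIV (x K)" "\<forall>K\<in>T. continuous_on UNIV (x' K)"
    "\<forall>K\<in>T. continuous_on UNIV (q K)" "\<forall>K\<in>T. continuous_on UNIV (q' K)"
    using u v y by (auto simp: represents_def)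
  have 1: "grad_form ?w' q' = grad_form w' q' + s * grad_form x' q'"
    unfolding grad_form_def sum_distrib_left sum.distrib[symmetric]
  proof (rule sum.cong[OF refl])
    fix K assume K: "K \<in> T"
    have "(LINT p|lebesgue_on (rect_set K). (snd p)\<^sup>2 * (?w' K p * q' K p)) =
      (LINT p|lebesgue_on (rect_set K). (snd p)\<^sup>2 * (w' K p * q' K p)) + s * (LINT p|lebesgue_on (rect_set K). (snd p)\<^sup>2 * (x' K p * q' K p))"
      using c K by (intro integral_lin integrable_rect) (auto intro!: continuous_intros simp: algebra_simps)
    then show "inverse (sigK \<sigma>t K) * (LINT p|lebesgue_on (rect_set K). (snd p)\<^sup>2 * (?w' K p * q' K p)) =
       inverse (sigK \<sigma>t K) * (LINT p|lebesgue_on (rect_set K). (snd p)\<^sup>2 * (w' K p * q' K p)) +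
       s * (inverse (sigK \<sigma>t K) * (LINT p|lebesgue_on (rect_set K). (snd p)\<^sup>2 * (x' K p * q' K p)))"
      by (simp add: algebra_simps)
  qed
  have 2: "mass_form ?w q = mass_form w q + s * mass_form x q"
    unfolding mass_form_def sum_distrib_left sum.distrib[symmetric]
  proof (rule sum.cong[OF refl])
    fix K assume K: "K \<in> T"
    have "(LINT p|lebesgue_on (rect_set K). ?w K p * q K p) =
      (LINT p|lebesgue_on (rect_set K). w K p * q K p) + s * (LINT p|lebesgue_on (rect_set K). x K p * q K p)"
      using c K by (intro integral_lin integrable_rect) (auto intro!: continuous_intros simp: algebra_simps)
    then show "sigK \<sigma>t K * (LINT p|lebesgue_on (rect_set K). ?w K p * q K p) =
       sigK \<sigma>t K * (LINT p|lebesgue_on (rect_set K). w K p * q K p) +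
       s * (sigK \<sigma>t K * (LINT p|lebesgue_on (rect_set K). x K p * q K p))"
      by (simp add: algebra_simps)
  qed
  note b = represents_bdd_borel[OF u] represents_bdd_borel[OF v] represents_bdd_borel[OF y]
  have 3: "scatter_form ?u y = scatter_form u y + s * scatter_form v y"
    unfolding scatter_form_def slice_mean_lin[OF b(1,2)]
    by (intro integral_lin bdd_borel_integrable bdd_borel_mult bdd_borel_slice_mean \<rho>_bdd b)
       (auto simp: algebra_simps)
  \<comment> \<open>The weight \<mu> is unbounded on the real line, so it is first cut off to (0,1)
    to stay among bounded Borel functions.\<close>
  have bt: "integrable (lebesgue_on {0<..<1})
     (\<lambda>\<mu>. (left_trace T f L \<mu> * left_trace T g L \<mu> + right_trace T f 0 \<mu> * right_trace T g 0 \<mu>) * \<mu>)"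
    if "\<forall>K\<in>T. continuous_on UNIV (f K)" "\<forall>K\<in>T. continuous_on UNIV (g K)" for f g
  proof -
    have "integrable (lebesgue_on {0<..<1})
     (\<lambda>\<mu>. (left_trace T f L \<mu> * left_trace T g L \<mu> + right_trace T f 0 \<mu> * right_trace T g 0 \<mu>) * (indicator {0<..<1} \<mu> * \<mu>))"
      by (intro bdd_borel_integrable bdd_borel_mult bdd_borel_add bdd_borel_left_trace bdd_borel_right_trace that
           bdd_borel_indicator_continuous continuous_intros) auto
    then show ?thesis
      by (rule Bochner_Integration.integrable_cong[THEN iffD1, rotated 2]) (auto simp: space_restrict_space)
  qed
  have 4: "bdry_form ?w q = bdry_form w q + s * bdry_form x q"
    unfolding bdry_form_def left_trace_lin right_trace_lin
    by (intro integral_lin bt c) (simp add: algebra_simps)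
  have fa: "face_avg F ?w' \<mu> = face_avg F w' \<mu> + s * face_avg F x' \<mu>"
    and fj: "face_jump F ?w \<mu> = face_jump F w \<mu> + s * face_jump F x \<mu>" for F \<mu>
    by (simp_all add: face_avg_def face_jump_def algebra_simps add_divide_distrib)
  have 5: "flux_form F ?w' q + flux_form F q' ?w = (flux_form F w' q + flux_form F q' w) + s * (flux_form F x' q + flux_form F q' x)"
    if F: "F \<in> vfaces T" for F
  proof -
    have "flux_form F ?w' q = flux_form F w' q + s * flux_form F x' q"
      unfolding flux_form_def fa
      by (intro integral_lin integrable_face continuous_intros continuous_face F c) (simp add: algebra_simps)
    moreover have "flux_form F q' ?w = flux_form F q' w + s * flux_form F q' x"
      unfolding flux_form_def fj
      by (intro integral_lin integrable_face continuous_intros continuous_face F c) (simp add: algebra_simps)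
    ultimately show ?thesis by (simp add: algebra_simps)
  qed
  have 6: "jump_form F ?w q = jump_form F w q + s * jump_form F x q" if F: "F \<in> vfaces T" for F
    unfolding jump_form_def fj
    by (intro integral_lin integrable_face continuous_intros continuous_face F c) (simp add: algebra_simps)
  have 7: "(\<Sum>F\<in>vfaces T. flux_form F ?w' q + flux_form F q' ?w) =
      (\<Sum>F\<in>vfaces T. flux_form F w' q + flux_form F q' w) + s * (\<Sum>F\<in>vfaces T. flux_form F x' q + flux_form F q' x)"
    unfolding sum_distrib_left sum.distrib[symmetric] using 5 by (intro sum.cong refl) simp
  have 8: "(\<Sum>F\<in>vfaces T. \<alpha> F / DF \<sigma>t F * jump_form F ?w q) =
      (\<Sum>F\<in>vfaces T. \<alpha> F / DF \<sigma>t F * jump_form F w q) + s * (\<Sum>F\<in>vfaces T. \<alpha> F / DF \<sigma>t F * jump_form F x q)"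
    using 6 by (simp add: sum.distrib sum_distrib_left algebra_simps)
  show ?thesis
    unfolding a_h_eq[OF uv y] a_h_eq[OF u y] a_h_eq[OF v y] 1 2 3 4 7 8 by (simp add: algebra_simps)
qed

end

section \<open>Coercivity\<close>

text \<open>Intended for the strips next to the faces of one element. They need not fill A, since an
  edge on the boundary of the domain carries no interior face; nonnegativity of g lets the remainder
  be dropped.\<close>

lemma sum_disjoint_integral_le:
  fixes g :: "'a::euclidean_space \<Rightarrow> real"
  assumes "finite I" "\<And>i. i \<in> I \<Longrightarrow> S i \<in> sets borel" "\<And>i. i \<in> I \<Longrightarrow> S i \<subseteq> A"
    and A: "A \<in> sets borel" "bounded A" and disj: "disjoint_family_on S I"
    and g: "bdd_borel g" "\<And>x. g x \<ge> 0"
  shows "(\<Sum>i\<in>I. LINT x|lebesgue_on (S i). g x) \<le> (LINT x|lebesgue_on A. g x)"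
proof -
  have ind: "bdd_borel (indicator (S i) :: 'a \<Rightarrow> real)" if "i \<in> I" for i
    using assms(2)[OF that] unfolding bdd_borel_def by (auto simp: indicator_def intro!: exI[of _ 1])
  have "(\<Sum>i\<in>I. LINT x|lebesgue_on (S i). g x) = (\<Sum>i\<in>I. LINT x|lebesgue_on A. indicator (S i) x * g x)"
  proof (rule sum.cong[OF refl])
    fix i assume i: "i \<in> I"
    have eq: "indicator A x * (indicator (S i) x * g x) = indicator (S i) x * g x" for x
      using assms(3)[OF i] by (auto simp: indicator_def)
    show "(LINT x|lebesgue_on (S i). g x) = (LINT x|lebesgue_on A. indicator (S i) x * g x)"
      using lebesgue_on_integral_lborel[OF assms(2)[OF i] bdd_borel_measurable[OF g(1)]]
        lebesgue_on_integral_lborel[OF A(1) bdd_borel_measurable[OF bdd_borel_mult[OF ind[OF i] g(1)]]]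
      unfolding eq by simp
  qed
  also have "\<dots> = (LINT x|lebesgue_on A. (\<Sum>i\<in>I. indicator (S i) x * g x))"
    by (intro Bochner_Integration.integral_sum[symmetric] bdd_borel_integrable bdd_borel_mult ind g A)
  also have "\<dots> \<le> (LINT x|lebesgue_on A. g x)"
  proof (intro integral_mono bdd_borel_integrable bdd_borel_sum bdd_borel_mult ind g A)
    fix x
    have "(\<Sum>i\<in>I. indicator (S i) x * g x) = indicator (\<Union>(S ` I)) x * g x"
      by (simp add: indicator_UN_disjoint[OF assms(1) disj] sum_distrib_right)
    also have "\<dots> \<le> g x" using g(2)[of x] by (auto simp: indicator_def)
    finally show "(\<Sum>i\<in>I. indicator (S i) x * g x) \<le> g x" .
  qed
  finally show ?thesis .
qed

lemma rect_set_box: "rect_set K = box (zl K, ml K) (zr K, mr K)"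
  by (auto simp: rect_set_def box_def Basis_prod_def)

text \<open>Jensen's inequality as nonnegativity of the variance; (0,1) has measure 1.\<close>

lemma slice_mean_square_le:
  assumes "bdd_borel u"
  shows "(slice_mean u z)\<^sup>2 \<le> slice_mean (\<lambda>p. u p * u p) z"
proof -
  let ?M = "lebesgue_on {0<..<1::real}"
  let ?m = "slice_mean u z"
  have b: "bdd_borel (\<lambda>\<mu>. u (z, \<mu>))" by (rule bdd_borel_slice[OF assms])
  have i: "integrable ?M (\<lambda>\<mu>. u (z, \<mu>))" "integrable ?M (\<lambda>\<mu>. u (z, \<mu>) * u (z, \<mu>))" "integrable ?M (\<lambda>\<mu>. ?m\<^sup>2)"
    by (intro bdd_borel_integrable bdd_borel_mult bdd_borel_const b; simp)+
  have one: "(LINT \<mu>|?M. ?m\<^sup>2) = ?m\<^sup>2" by (simp add: measure_restrict_space)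
  have "0 \<le> (LINT \<mu>|?M. (u (z, \<mu>) - ?m)\<^sup>2)" by (rule Bochner_Integration.integral_nonneg) simp
  also have "\<dots> = (LINT \<mu>|?M. (u (z, \<mu>) * u (z, \<mu>) - 2 * ?m * u (z, \<mu>)) + ?m\<^sup>2)"
    by (intro Bochner_Integration.integral_cong refl) (simp add: power2_eq_square algebra_simps)
  also have "\<dots> = slice_mean (\<lambda>p. u p * u p) z - 2 * ?m * ?m + ?m\<^sup>2"
    using i one by (simp add: slice_mean_def)
  finally show ?thesis by (simp add: power2_eq_square)
qed

context dg_problem
begin

lemma zl_zr_sub:
  assumes "K \<in> T"
  shows "{zl K<..<zr K} \<subseteq> {0<..<L}" "{ml K<..<mr K} \<subseteq> {0<..<1}"
proof -
  have "((zl K + zr K) / 2, \<mu>) \<in> rect_set K" if "\<mu> \<in> {ml K<..<mr K}" for \<mu>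
    using that zl_less_zr[OF assms] by (auto simp: mem_rect_set)
  moreover have "(z, (ml K + mr K) / 2) \<in> rect_set K" if "z \<in> {zl K<..<zr K}" for z
    using that ml_less_mr[OF assms] by (auto simp: mem_rect_set)
  ultimately show "{zl K<..<zr K} \<subseteq> {0<..<L}" "{ml K<..<mr K} \<subseteq> {0<..<1}"
    using rect_sub[OF assms] unfolding Omega_def by blast+
qed

text \<open>The bound on \<sigma>t holds only almost everywhere, but \<sigma>t is constant on the
  element, whose z-interval has positive length; a violation would therefore fill a set of positive
  measure.\<close>

lemma sigK_ge:
  assumes K: "K \<in> T"
  shows "sigK \<sigma>t K \<ge> c"
proof (rule ccontr)
  assume less: "\<not> sigK \<sigma>t K \<ge> c"
  have "AE z in lborel. z \<in> {0<..<L} \<longrightarrow> \<sigma>t z - \<rho> z \<ge> c"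
    using absorb by (simp add: AE_restrict_space_iff AE_completion_iff)
  then have "AE z in lborel. z \<notin> {zl K<..<zr K}"
  proof eventually_elim
    case (elim z)
    show ?case
    proof
      assume z: "z \<in> {zl K<..<zr K}"
      then have "\<sigma>t z = sigK \<sigma>t K" by (rule \<sigma>t_eq[OF K])
      moreover have "z \<in> {0<..<L}" using z zl_zr_sub(1)[OF K] by blast
      ultimately show False using elim \<rho>_nonneg[of z] less by simp
    qed
  qed
  then have "emeasure lborel {zl K<..<zr K} = 0"
    by (subst (asm) AE_iff_measurable[of "{zl K<..<zr K}"]) auto
  then show False using zl_less_zr[OF K] by simp
qed

lemma sigK_pos: "K \<in> T \<Longrightarrow> sigK \<sigma>t K > 0"
  using sigK_ge[of K] c_pos by linarith

lemma hK_pos: "K \<in> T \<Longrightarrow> hK K > 0"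
  using zl_less_zr by (simp add: hK_def)

text \<open>Jensen and Fubini bound the scattering term by the integral of \<rho> u^2 over
  \<open>Omega L\<close>. The mass term has density \<sigma>t u^2 there, and the two densities
  differ by at least c u^2 almost everywhere.\<close>

lemma mass_minus_scatter_ge:
  assumes u: "represents T u w w'"
  shows "c * (LINT p|lebesgue_on (Omega L). u p * u p) \<le> mass_form w w - scatter_form u u"
proof -
  note b = represents_bdd_borel[OF u]
  have "scatter_form u u \<le> (LINT z|lebesgue_on {0<..<L}. slice_mean (\<lambda>p. \<rho> (fst p) * (u p * u p)) z)"
    unfolding scatter_form_def
  proof (intro integral_mono bdd_borel_integrable bdd_borel_mult bdd_borel_slice_mean b \<rho>_bdd bdd_borel_fst)
    fix z
    have "slice_mean (\<lambda>p. \<rho> (fst p) * (u p * u p)) z = \<rho> z * slice_mean (\<lambda>p. u p * u p) z"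
      by (simp add: slice_mean_def)
    moreover have "\<rho> z * (slice_mean u z)\<^sup>2 \<le> \<rho> z * slice_mean (\<lambda>p. u p * u p) z"
      by (intro mult_left_mono slice_mean_square_le b \<rho>_nonneg)
    ultimately show "\<rho> z * (slice_mean u z * slice_mean u z) \<le> slice_mean (\<lambda>p. \<rho> (fst p) * (u p * u p)) z"
      by (simp add: power2_eq_square)
  qed auto
  also have "\<dots> = (LINT p|lebesgue_on (Omega L). \<rho> (fst p) * (u p * u p))"
    unfolding slice_mean_def by (intro Fubini_Omega[symmetric] bdd_borel_mult b bdd_borel_fst \<rho>_bdd)
  finally have 1: "scatter_form u u \<le> (LINT p|lebesgue_on (Omega L). \<rho> (fst p) * (u p * u p))" .
  have ii: "integrable (lebesgue_on (Omega L)) (\<lambda>p. u p * u p)"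
    "integrable (lebesgue_on (Omega L)) (\<lambda>p. \<rho> (fst p) * (u p * u p))"
    using open_Omega bounded_Omega by (intro bdd_borel_integrable bdd_borel_mult b bdd_borel_fst \<rho>_bdd; auto)+
  let ?f = "\<lambda>K p. sigK \<sigma>t K * (w K p * w K p)"
  have cf: "\<forall>K\<in>T. continuous_on UNIV (?f K)"
    using u unfolding represents_def by (auto intro!: continuous_intros)
  have "AE p in lebesgue_on (Omega L). \<sigma>t (fst p) - \<rho> (fst p) \<ge> c"
    unfolding Omega_def using absorb by (rule AE_lebesgue_on_fst) auto
  then have "AE p in lebesgue_on (Omega L). c * (u p * u p) + \<rho> (fst p) * (u p * u p) \<le> pw T ?f p"
  proof eventually_elim
    fix p :: "real \<times> real" assume ab: "\<sigma>t (fst p) - \<rho> (fst p) \<ge> c"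
    have up: "u p = pw T w p" using u by (simp add: represents_def)
    show "c * (u p * u p) + \<rho> (fst p) * (u p * u p) \<le> pw T ?f p"
    proof (cases "\<exists>K\<in>T. p \<in> rect_set K")
      case True
      then obtain K where K: "K \<in> T" "p \<in> rect_set K" by blast
      have "\<sigma>t (fst p) = sigK \<sigma>t K" using \<sigma>t_eq[OF K(1), of "fst p"] K(2) by (cases p) (auto simp: mem_rect_set)
      then have "(c + \<rho> (fst p)) * (w K p * w K p) \<le> sigK \<sigma>t K * (w K p * w K p)"
        using ab by (intro mult_right_mono) auto
      then show ?thesis by (simp add: up pw_eq[OF K] distrib_right)
    next
      case False
      then show ?thesis by (simp add: up pw_zero)
    qed
  qed
  then have "(LINT p|lebesgue_on (Omega L). c * (u p * u p) + \<rho> (fst p) * (u p * u p)) \<le> (LINT p|lebesgue_on (Omega L). pw T ?f p)"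
    using ii open_Omega bounded_Omega
    by (intro integral_mono_AE bdd_borel_integrable[OF bdd_borel_pw[OF cf]]) auto
  also have "\<dots> = mass_form w w" unfolding mass_form_def integral_pw[OF cf] by simp
  finally show ?thesis using ii 1 by simp
qed

text \<open>The energy of \<mu> times the z-derivative along one horizontal line through K.
  Integrating it over any range of \<mu> gives the energy on that strip, so a face covering only
  part of an edge needs no special treatment. The indicator makes it a bounded Borel function on the
  whole line.\<close>

definition slice_energy :: "(rect \<Rightarrow> real \<times> real \<Rightarrow> real) \<Rightarrow> rect \<Rightarrow> real \<Rightarrow> real" where
  "slice_energy w' K \<mu> = (LINT z|lebesgue_on {zl K<..<zr K}.
     indicator (rect_set K) (z, \<mu>) * (\<mu>\<^sup>2 * (w' K (z, \<mu>) * w' K (z, \<mu>))))"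

lemma slice_energy_nonneg: "slice_energy w' K \<mu> \<ge> 0"
  unfolding slice_energy_def by (rule Bochner_Integration.integral_nonneg) (simp add: indicator_def)

lemma bdd_borel_slice_energy:
  assumes "continuous_on UNIV (w' K)"
  shows "bdd_borel (slice_energy w' K)"
proof -
  have "bdd_borel (\<lambda>p. indicator (rect_set K) p * ((snd p)\<^sup>2 * (w' K p * w' K p)))"
    using assms open_rect_set bounded_rect_set
    by (intro bdd_borel_indicator_continuous continuous_intros) auto
  from bdd_borel_slice_integral[OF bdd_borel_swap[OF this], of "{zl K<..<zr K}"] show ?thesis
    by (simp add: slice_energy_def[abs_def])
qed

lemma integral_slice_energy:
  assumes "continuous_on UNIV (w' K)"
  shows "(LINT \<mu>|lebesgue_on {ml K<..<mr K}. slice_energy w' K \<mu>) =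
     (LINT p|lebesgue_on (rect_set K). (snd p)\<^sup>2 * (w' K p * w' K p))"
proof -
  let ?h = "\<lambda>p. indicator (rect_set K) p * ((snd p)\<^sup>2 * (w' K p * w' K p))"
  have "bdd_borel ?h"
    using assms open_rect_set bounded_rect_set
    by (intro bdd_borel_indicator_continuous continuous_intros) auto
  then have "(LINT p|lebesgue_on (rect_set K). ?h p) = (LINT \<mu>|lebesgue_on {ml K<..<mr K}. slice_energy w' K \<mu>)"
    unfolding slice_energy_def rect_set_def by (subst Fubini_rectangle(2)) auto
  moreover have "(LINT p|lebesgue_on (rect_set K). ?h p) = (LINT p|lebesgue_on (rect_set K). (snd p)\<^sup>2 * (w' K p * w' K p))"
    by (intro Bochner_Integration.integral_cong refl) (simp add: space_restrict_space)
  ultimately show ?thesis by simp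
qed

text \<open>On a slice \<mu> is a constant, so the one-dimensional trace inequality carries over
  after multiplication by \<mu>^2.\<close>

lemma slice_energy_trace:
  assumes K: "K \<in> T" and p: "degree p \<le> k" "\<And>z. w' K (z, \<mu>) = poly p z"
    and \<mu>: "\<mu> \<in> {ml K<..<mr K}" and e: "e = zl K \<or> e = zr K"
  shows "(\<mu> * w' K (e, \<mu>))\<^sup>2 \<le> C_dt k / hK K * slice_energy w' K \<mu>"
proof -
  have ct: "continuous_on S (\<lambda>z. (poly p z)\<^sup>2)" for S by (intro continuous_intros)
  have "slice_energy w' K \<mu> = (LINT z|lebesgue_on {zl K<..<zr K}. \<mu>\<^sup>2 * (poly p z)\<^sup>2)"
    unfolding slice_energy_def
    by (intro Bochner_Integration.integral_cong refl)
       (use \<mu> in \<open>auto simp: space_restrict_space p(2) mem_rect_set power2_eq_square\<close>)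
  also have "\<dots> = \<mu>\<^sup>2 * (LINT z|lebesgue_on {zl K<..<zr K}. (poly p z)\<^sup>2)" by simp
  also have "(LINT z|lebesgue_on {zl K<..<zr K}. (poly p z)\<^sup>2) = integral {zl K<..<zr K} (\<lambda>z. (poly p z)\<^sup>2)"
    by (intro lebesgue_integral_eq_integral continuous_integrable_bounded ct) auto
  also have "\<dots> = integral {zl K..zr K} (\<lambda>z. (poly p z)\<^sup>2)" by (rule integral_open_interval_real[symmetric])
  finally have E: "slice_energy w' K \<mu> = \<mu>\<^sup>2 * integral {zl K..zr K} (\<lambda>z. (poly p z)\<^sup>2)" .
  have "\<mu>\<^sup>2 * (poly p e)\<^sup>2 \<le> \<mu>\<^sup>2 * (C_dt k / (zr K - zl K) * integral {zl K..zr K} (\<lambda>z. (poly p z)\<^sup>2))"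
    using zl_less_zr[OF K] p(1) e by (intro mult_left_mono discrete_trace_inequality) auto
  then show ?thesis by (simp add: E p(2) hK_def power_mult_distrib mult_ac)
qed

text \<open>Two faces at the same height with the same left element lie on the same vertical line,
  so their right elements overlap just beyond it and must coincide; likewise with the sides
  exchanged. The strips of one element on a given side are disjoint for this reason.\<close>

lemma vface_determined:
  assumes F: "F \<in> vfaces T" "F' \<in> vfaces T" and \<mu>: "\<mu> \<in> {mbF F<..<mtF F}" "\<mu> \<in> {mbF F'<..<mtF F'}"
    and eq: "fst F = fst F' \<or> snd F = snd F'"
  shows "F = F'"
  using eq
proof
  assume 1: "fst F = fst F'"
  let ?p = "((min (zr (snd F)) (zr (snd F')) + zr (fst F)) / 2, \<mu>)"
  have "?p \<in> rect_set (snd F)" "?p \<in> rect_set (snd F')"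
    using 1 zl_less_zr[OF vface_in(2)[OF F(1)]] zl_less_zr[OF vface_in(2)[OF F(2)]]
      vface_in(3)[OF F(1)] vface_in(3)[OF F(2)] vface_mu(2)[OF \<mu>(1)] vface_mu(2)[OF \<mu>(2)]
    by (auto simp: mem_rect_set)
  then show ?thesis using 1 rect_disj vface_in(2)[OF F(1)] vface_in(2)[OF F(2)] by (metis prod_eqI)
next
  assume 1: "snd F = snd F'"
  let ?p = "((max (zl (fst F)) (zl (fst F')) + zr (fst F)) / 2, \<mu>)"
  have "?p \<in> rect_set (fst F)" "?p \<in> rect_set (fst F')"
    using 1 zl_less_zr[OF vface_in(1)[OF F(1)]] zl_less_zr[OF vface_in(1)[OF F(2)]]
      vface_in(3)[OF F(1)] vface_in(3)[OF F(2)] vface_mu(1)[OF \<mu>(1)] vface_mu(1)[OF \<mu>(2)]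
    by (auto simp: mem_rect_set)
  then show ?thesis using 1 rect_disj vface_in(1)[OF F(1)] vface_in(1)[OF F(2)] by (metis prod_eqI)
qed

text \<open>Faces are grouped by their element on the chosen side; within a group the strips are
  disjoint, so their integrals add up to at most the integral over the full height. Keeping
  \<open>side\<close> abstract covers left and right elements with one proof.\<close>

lemma sum_faces_le:
  assumes side: "side = fst \<or> side = snd" and a: "\<And>K. K \<in> T \<Longrightarrow> a K \<ge> 0"
    and g: "\<And>K. K \<in> T \<Longrightarrow> bdd_borel (g K)" "\<And>K x. g K x \<ge> 0"
  shows "(\<Sum>F\<in>vfaces T. a (side F) * (LINT \<mu>|lebesgue_on {mbF F<..<mtF F}. g (side F) \<mu>))
    \<le> (\<Sum>K\<in>T. a K * (LINT \<mu>|lebesgue_on {ml K<..<mr K}. g K \<mu>))"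
proof -
  let ?h = "\<lambda>F. a (side F) * (LINT \<mu>|lebesgue_on {mbF F<..<mtF F}. g (side F) \<mu>)"
  let ?I = "\<lambda>K. {F. F \<in> vfaces T \<and> side F = K}"
  have "sum ?h (vfaces T) = (\<Sum>K\<in>T. sum ?h (?I K))"
    using side by (intro sum.group[symmetric] finite_vfaces finite_T) (auto simp: vfaces_def)
  also have "\<dots> \<le> (\<Sum>K\<in>T. a K * (LINT \<mu>|lebesgue_on {ml K<..<mr K}. g K \<mu>))"
  proof (rule sum_mono)
    fix K assume K: "K \<in> T"
    have "sum ?h (?I K) = a K * (\<Sum>F\<in>?I K. LINT \<mu>|lebesgue_on {mbF F<..<mtF F}. g K \<mu>)"
      by (simp add: sum_distrib_left)
    also have "\<dots> \<le> a K * (LINT \<mu>|lebesgue_on {ml K<..<mr K}. g K \<mu>)"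
    proof (rule mult_left_mono[OF sum_disjoint_integral_le])
      show "disjoint_family_on (\<lambda>F. {mbF F<..<mtF F}) (?I K)"
        unfolding disjoint_family_on_def
      proof (intro ballI impI)
        fix F F' assume F: "F \<in> ?I K" "F' \<in> ?I K" "F \<noteq> F'"
        then have FF: "F \<in> vfaces T" "F' \<in> vfaces T" and "side F = side F'" by simp_all
        then have eq: "fst F = fst F' \<or> snd F = snd F'" using side by metis
        have False if "\<mu> \<in> {mbF F<..<mtF F}" "\<mu> \<in> {mbF F'<..<mtF F'}" for \<mu>
          using vface_determined[OF FF that eq] F(3) by simp
        then show "{mbF F<..<mtF F} \<inter> {mbF F'<..<mtF F'} = {}" by blast
      qed
      show "{mbF F<..<mtF F} \<subseteq> {ml K<..<mr K}" if F: "F \<in> ?I K" for F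
      proof
        fix \<mu> assume \<mu>: "\<mu> \<in> {mbF F<..<mtF F}"
        have "K = fst F \<or> K = snd F" using F side by (metis (mono_tags, lifting) mem_Collect_eq)
        then show "\<mu> \<in> {ml K<..<mr K}" using vface_mu[OF \<mu>] by metis
      qed
    qed (use finite_vfaces g K a in auto)
    finally show "sum ?h (?I K) \<le> a K * (LINT \<mu>|lebesgue_on {ml K<..<mr K}. g K \<mu>)" .
  qed
  finally show ?thesis .
qed

lemma inverse_DF:
  "1 / DF \<sigma>t F = 1 / (sigK \<sigma>t (fst F) * hK (fst F)) + 1 / (sigK \<sigma>t (snd F) * hK (snd F))"
  by (simp add: DF_def divide_inverse)

text \<open>The two halves of the average are estimated separately. With C = \<open>C_dt k\<close>,
  an element with coefficient s and width h leaves the factor C / (2 s h) on the squared jump; the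
  two sides add up to C/2 times \<open>1 / DF\<close>, which explains the harmonic form of
  \<open>DF\<close>.\<close>

lemma flux_form_le:
  assumes u: "represents T u w w'" and F: "F \<in> vfaces T"
    and pol: "\<forall>K\<in>T. \<forall>\<mu>. \<exists>p. degree p \<le> k \<and> (\<forall>z. w' K (z, \<mu>) = poly p z)"
  shows "2 * flux_form F w' w \<le>
      1 / (2 * sigK \<sigma>t (fst F)) * (LINT \<mu>|lebesgue_on {mbF F<..<mtF F}. slice_energy w' (fst F) \<mu>)
    + 1 / (2 * sigK \<sigma>t (snd F)) * (LINT \<mu>|lebesgue_on {mbF F<..<mtF F}. slice_energy w' (snd F) \<mu>)
    + C_dt k / 2 * (1 / DF \<sigma>t F) * jump_form F w w"
proof -
  define C s1 s2 h1 h2 where "C = C_dt k" and "s1 = sigK \<sigma>t (fst F)" and "s2 = sigK \<sigma>t (snd F)"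
    and "h1 = hK (fst F)" and "h2 = hK (snd F)"
  have pos: "C > 0" "s1 > 0" "s2 > 0" "h1 > 0" "h2 > 0"
    using C_dt_ge_1[of k] sigK_pos hK_pos vface_in[OF F] by (auto simp: C_def s1_def s2_def h1_def h2_def)
  let ?M = "lebesgue_on {mbF F<..<mtF F}"
  let ?A = "face_avg F w'" and ?J = "face_jump F w" and ?G1 = "slice_energy w' (fst F)" and ?G2 = "slice_energy w' (snd F)"
  have cw: "\<forall>K\<in>T. continuous_on UNIV (w K)" "\<forall>K\<in>T. continuous_on UNIV (w' K)"
    using u by (auto simp: represents_def)
  have iG: "integrable ?M ?G1" "integrable ?M ?G2"
    using cw vface_in[OF F] by (auto intro!: bdd_borel_integrable bdd_borel_slice_energy)
  have iJ: "integrable ?M (\<lambda>\<mu>. ?J \<mu> * ?J \<mu> * \<mu>)" "integrable ?M (\<lambda>\<mu>. ?A \<mu> * ?J \<mu> * \<mu>)"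
    by (intro integrable_face continuous_intros continuous_face F cw)+
  have pt: "2 * (?A \<mu> * ?J \<mu> * \<mu>) \<le> 1 / (2 * s1) * ?G1 \<mu> + 1 / (2 * s2) * ?G2 \<mu>
       + C / 2 * (1 / (s1 * h1) + 1 / (s2 * h2)) * (?J \<mu> * ?J \<mu> * \<mu>)" if \<mu>: "\<mu> \<in> {mbF F<..<mtF F}" for \<mu>
  proof -
    have m: "\<mu> \<in> {ml (fst F)<..<mr (fst F)}" "\<mu> \<in> {ml (snd F)<..<mr (snd F)}" using vface_mu[OF \<mu>] by auto
    then have \<mu>01: "0 \<le> \<mu>" "\<mu> \<le> 1" using zl_zr_sub(2)[OF vface_in(1)[OF F]] by auto
    obtain p1 where p1: "degree p1 \<le> k" "\<And>z. w' (fst F) (z, \<mu>) = poly p1 z" using pol vface_in(1)[OF F] by blast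
    obtain p2 where p2: "degree p2 \<le> k" "\<And>z. w' (snd F) (z, \<mu>) = poly p2 z" using pol vface_in(2)[OF F] by blast
    define D1 D2 J where "D1 = \<mu> * w' (fst F) (zF F, \<mu>)" and "D2 = \<mu> * w' (snd F) (zF F, \<mu>)" and "J = ?J \<mu>"
    have T1: "D1\<^sup>2 \<le> C / h1 * ?G1 \<mu>"
      unfolding D1_def C_def h1_def using cw vface_in[OF F] m
      by (intro slice_energy_trace[where p=p1] p1) (auto simp: zF_def)
    have T2: "D2\<^sup>2 \<le> C / h2 * ?G2 \<mu>"
      unfolding D2_def C_def h2_def using cw vface_in[OF F] m
      by (intro slice_energy_trace[where p=p2] p2) (auto simp: zF_def)
    \<comment> \<open>Young's inequality with weight \<open>h / C\<close>, then the trace inequality for \<open>D\<close>\<close>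
    have young: "D * J * \<mu> / s \<le> 1 / (2 * s) * G + C / 2 * (1 / (s * h)) * (J * J * \<mu>)"
      if D: "D\<^sup>2 \<le> C / h * G" and "s > 0" "h > 0" for D G s h :: real
    proof -
      have "0 \<le> (h * D - C * J)\<^sup>2 / (h * C)" using that pos by simp
      also have "\<dots> = h / C * D\<^sup>2 + C / h * J\<^sup>2 - 2 * (D * J)"
        using that pos by (simp add: power2_eq_square field_simps)
      finally have "D * J \<le> (h / C * D\<^sup>2 + C / h * J\<^sup>2) / 2" by simp
      then have "D * J * \<mu> \<le> (h / C * D\<^sup>2 + C / h * J\<^sup>2) / 2 * \<mu>" using \<mu>01(1) by (rule mult_right_mono)
      also have "\<dots> = h / C * D\<^sup>2 / 2 * \<mu> + C / h * J\<^sup>2 / 2 * \<mu>" by (simp add: algebra_simps add_divide_distrib)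
      \<comment> \<open>\<open>slice_energy\<close> does not carry the additional face weight \<mu>,
        so \<mu> \<le> 1 is used on the gradient part; the jump part keeps its weight to match
        \<open>jump_form\<close>.\<close>
      also have "h / C * D\<^sup>2 / 2 * \<mu> \<le> h / C * D\<^sup>2 / 2" using \<mu>01 that pos by (intro mult_left_le) auto
      also have "h / C * D\<^sup>2 / 2 \<le> h / C * (C / h * G) / 2"
        using D that pos by (intro divide_right_mono mult_left_mono) auto
      also have "h / C * (C / h * G) / 2 = G / 2" using that pos by simp
      finally have "D * J * \<mu> / s \<le> (G / 2 + C / h * J\<^sup>2 / 2 * \<mu>) / s" using that by (intro divide_right_mono) auto
      also have "\<dots> = 1 / (2 * s) * G + C / 2 * (1 / (s * h)) * (J * J * \<mu>)"
        by (simp add: power2_eq_square add_divide_distrib mult_ac)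
      finally show ?thesis .
    qed
    have "?A \<mu> = (D1 / s1 + D2 / s2) / 2" by (simp add: face_avg_def D1_def D2_def s1_def s2_def)
    then have "2 * (?A \<mu> * ?J \<mu> * \<mu>) = (D1 / s1 + D2 / s2) * (J * \<mu>)" by (simp only: J_def) simp
    also have "\<dots> = D1 * J * \<mu> / s1 + D2 * J * \<mu> / s2" by (simp add: distrib_right)
    finally have "2 * (?A \<mu> * ?J \<mu> * \<mu>) = D1 * J * \<mu> / s1 + D2 * J * \<mu> / s2" .
    also have "\<dots> \<le> (1 / (2 * s1) * ?G1 \<mu> + C / 2 * (1 / (s1 * h1)) * (J * J * \<mu>))
        + (1 / (2 * s2) * ?G2 \<mu> + C / 2 * (1 / (s2 * h2)) * (J * J * \<mu>))"
      by (intro add_mono young T1 T2 pos)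
    also have "\<dots> = 1 / (2 * s1) * ?G1 \<mu> + 1 / (2 * s2) * ?G2 \<mu>
       + C / 2 * (1 / (s1 * h1) + 1 / (s2 * h2)) * (J * J * \<mu>)"
      by (simp only: distrib_left distrib_right add_ac)
    finally show ?thesis unfolding J_def .
  qed
  have "2 * flux_form F w' w = (LINT \<mu>|?M. 2 * (?A \<mu> * ?J \<mu> * \<mu>))" by (simp add: flux_form_def)
  also have "\<dots> \<le> (LINT \<mu>|?M. 1 / (2 * s1) * ?G1 \<mu> + 1 / (2 * s2) * ?G2 \<mu>
       + C / 2 * (1 / (s1 * h1) + 1 / (s2 * h2)) * (?J \<mu> * ?J \<mu> * \<mu>))"
    by (intro integral_mono pt Bochner_Integration.integrable_add integrable_mult_right iG iJ)
       (simp add: space_restrict_space)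
  also have "\<dots> = 1 / (2 * s1) * (LINT \<mu>|?M. ?G1 \<mu>) + 1 / (2 * s2) * (LINT \<mu>|?M. ?G2 \<mu>)
       + C / 2 * (1 / (s1 * h1) + 1 / (s2 * h2)) * jump_form F w w"
    unfolding jump_form_def
    by (simp only: Bochner_Integration.integral_add integral_mult_right_zero integrable_mult_right iG iJ
        Bochner_Integration.integrable_add)
  finally show ?thesis unfolding inverse_DF C_def s1_def s2_def h1_def h2_def .
qed

lemma a_h_coercive:
  assumes u: "represents T u w w'"
    and pol: "\<forall>K\<in>T. \<forall>\<mu>. \<exists>p. degree p \<le> k \<and> (\<forall>z. w' K (z, \<mu>) = poly p z)"
    and \<alpha>: "\<forall>F\<in>vfaces T. \<alpha> F \<ge> C_dt k / 2"
  shows "c * (LINT p|lebesgue_on (Omega L). u p * u p) \<le> a_h L \<sigma>s \<sigma>t T \<alpha> u u"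
proof -
  have cw: "\<forall>K\<in>T. continuous_on UNIV (w K)" "\<forall>K\<in>T. continuous_on UNIV (w' K)"
    using u by (auto simp: represents_def)
  let ?E = "\<lambda>K F. LINT \<mu>|lebesgue_on {mbF F<..<mtF F}. slice_energy w' K \<mu>"
  have "(\<Sum>F\<in>vfaces T. flux_form F w' w + flux_form F w' w) \<le>
    (\<Sum>F\<in>vfaces T. 1 / (2 * sigK \<sigma>t (fst F)) * ?E (fst F) F + 1 / (2 * sigK \<sigma>t (snd F)) * ?E (snd F) F
       + \<alpha> F / DF \<sigma>t F * jump_form F w w)"
  proof (rule sum_mono)
    fix F assume F: "F \<in> vfaces T"
    have J: "jump_form F w w \<ge> 0"
      unfolding jump_form_def
    proof (rule Bochner_Integration.integral_nonneg)
      fix \<mu> assume "\<mu> \<in> space (lebesgue_on {mbF F<..<mtF F})"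
      then have "\<mu> \<in> {ml (fst F)<..<mr (fst F)}" using vface_mu(1)[of \<mu> F] by (simp add: space_restrict_space)
      then have "\<mu> \<ge> 0" using zl_zr_sub(2)[OF vface_in(1)[OF F]] by auto
      then show "0 \<le> face_jump F w \<mu> * face_jump F w \<mu> * \<mu>" by simp
    qed
    have "1 / DF \<sigma>t F \<ge> 0"
      unfolding inverse_DF using sigK_pos hK_pos vface_in[OF F] by (auto intro!: add_nonneg_nonneg simp: less_imp_le)
    then have "C_dt k / 2 * (1 / DF \<sigma>t F) * jump_form F w w \<le> \<alpha> F * (1 / DF \<sigma>t F) * jump_form F w w"
      using \<alpha> F J by (intro mult_right_mono) auto
    with flux_form_le[OF u F pol]
    show "flux_form F w' w + flux_form F w' w \<le> 1 / (2 * sigK \<sigma>t (fst F)) * ?E (fst F) F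
       + 1 / (2 * sigK \<sigma>t (snd F)) * ?E (snd F) F + \<alpha> F / DF \<sigma>t F * jump_form F w w"
      by simp
  qed
  moreover have "(\<Sum>F\<in>vfaces T. 1 / (2 * sigK \<sigma>t (side F)) * ?E (side F) F) \<le> grad_form w' w' / 2"
    if side: "side = fst \<or> side = snd" for side :: "rect \<times> rect \<Rightarrow> rect"
  proof -
    have "(\<Sum>F\<in>vfaces T. 1 / (2 * sigK \<sigma>t (side F)) * ?E (side F) F) \<le>
       (\<Sum>K\<in>T. 1 / (2 * sigK \<sigma>t K) * (LINT \<mu>|lebesgue_on {ml K<..<mr K}. slice_energy w' K \<mu>))"
      using side cw sigK_pos slice_energy_nonneg
      by (intro sum_faces_le[where a="\<lambda>K. 1 / (2 * sigK \<sigma>t K)"] bdd_borel_slice_energy) (auto simp: less_imp_le)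
    also have "\<dots> = grad_form w' w' / 2"
      unfolding grad_form_def sum_divide_distrib using cw
      by (intro sum.cong refl) (simp add: integral_slice_energy inverse_eq_divide)
    finally show ?thesis .
  qed
  from this[of fst] this[of snd]
  have "(\<Sum>F\<in>vfaces T. 1 / (2 * sigK \<sigma>t (fst F)) * ?E (fst F) F)
    + (\<Sum>F\<in>vfaces T. 1 / (2 * sigK \<sigma>t (snd F)) * ?E (snd F) F) \<le> grad_form w' w'" by simp
  moreover have "bdry_form w w \<ge> 0"
    unfolding bdry_form_def by (rule Bochner_Integration.integral_nonneg) (auto simp: space_restrict_space)
  ultimately show ?thesis
    using mass_minus_scatter_ge[OF u] unfolding a_h_eq[OF u u] sum.distrib by linarith
qed

text \<open>Coercivity makes the integral of the squared piece vanish on each element, and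
  continuity turns this into pointwise vanishing. Off the open elements u is 0 by its
  representation, so u vanishes as a function and not merely almost everywhere.\<close>

lemma a_h_definite:
  assumes u: "represents T u w w'"
    and pol: "\<forall>K\<in>T. \<forall>\<mu>. \<exists>p. degree p \<le> k \<and> (\<forall>z. w' K (z, \<mu>) = poly p z)"
    and \<alpha>: "\<forall>F\<in>vfaces T. \<alpha> F \<ge> C_dt k / 2"
    and zero: "a_h L \<sigma>s \<sigma>t T \<alpha> u u = 0"
  shows "u = (\<lambda>p. 0)"
proof -
  have cw: "\<forall>K\<in>T. continuous_on UNIV (w K)" and up: "u = pw T w"
    using u by (auto simp: represents_def)
  then have cw2: "\<forall>K\<in>T. continuous_on UNIV (\<lambda>p. w K p * w K p)" by (auto intro!: continuous_intros)
  have "c * (LINT p|lebesgue_on (Omega L). u p * u p) \<le> 0" using a_h_coercive[OF u pol \<alpha>] zero by simp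
  then have "(LINT p|lebesgue_on (Omega L). pw T (\<lambda>K p. w K p * w K p) p) \<le> 0"
    using c_pos by (simp add: up pw_mult mult_le_0_iff)
  then have "(\<Sum>K\<in>T. LINT p|lebesgue_on (rect_set K). w K p * w K p) \<le> 0"
    unfolding integral_pw[OF cw2] .
  moreover have nn: "(LINT p|lebesgue_on (rect_set K). w K p * w K p) \<ge> 0" for K by (rule Bochner_Integration.integral_nonneg) simp
  ultimately have "(\<Sum>K\<in>T. LINT p|lebesgue_on (rect_set K). w K p * w K p) = 0"
    by (meson antisym sum_nonneg)
  then have z: "(LINT p|lebesgue_on (rect_set K). w K p * w K p) = 0" if "K \<in> T" for K
    using that finite_T nn by (simp add: sum_nonneg_eq_0_iff)
  have "w K p = 0" if K: "K \<in> T" and p: "p \<in> rect_set K" for K p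
  proof -
    let ?a = "(zl K, ml K)" and ?b = "(zr K, mr K)"
    have "0 = integral (rect_set K) (\<lambda>p. w K p * w K p)"
      unfolding z[OF K, symmetric] using open_rect_set cw2 K
      by (intro lebesgue_integral_eq_integral integrable_rect) auto
    also have "\<dots> = integral (cbox ?a ?b) (\<lambda>p. w K p * w K p)"
      unfolding rect_set_box by (rule integral_open_interval)
    finally have "\<forall>p\<in>cbox ?a ?b. w K p * w K p = 0"
      using cw2 K p continuous_on_subset[of UNIV "\<lambda>p. w K p * w K p"] unfolding rect_set_box
      by (subst integral_cbox_eq_0_iff[symmetric]) auto
    then show ?thesis using p box_subset_cbox unfolding rect_set_box by fastforce
  qed
  then show ?thesis unfolding up pw_def by (auto simp: fun_eq_iff indicator_def intro!: sum.neutral)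
qed

end

section \<open>The discrete space and the load functional\<close>

definition tensor_poly :: "nat \<Rightarrow> nat \<Rightarrow> (nat \<Rightarrow> nat \<Rightarrow> real) \<Rightarrow> real \<times> real \<Rightarrow> real" where
  "tensor_poly m n c p = (\<Sum>i\<le>m. \<Sum>j\<le>n. c i j * fst p ^ i * snd p ^ j)"

text \<open>At i = 0 the truncated exponent is harmless because the factor \<open>real i\<close>
  vanishes.\<close>

definition tensor_poly_dz :: "nat \<Rightarrow> nat \<Rightarrow> (nat \<Rightarrow> nat \<Rightarrow> real) \<Rightarrow> real \<times> real \<Rightarrow> real" where
  "tensor_poly_dz m n c p = (\<Sum>i\<le>m. \<Sum>j\<le>n. c i j * (real i * fst p ^ (i - 1)) * snd p ^ j)"

definition Vh_basis :: "rect \<times> nat \<times> nat \<Rightarrow> real \<times> real \<Rightarrow> real" where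
  "Vh_basis = (\<lambda>(K, i, j) p. indicator (rect_set K) p * (fst p ^ i * snd p ^ j))"

lemma represents_tensor_poly:
  "represents T (pw T (\<lambda>K. tensor_poly m n (c K))) (\<lambda>K. tensor_poly m n (c K)) (\<lambda>K. tensor_poly_dz m n (c K))"
  unfolding represents_def tensor_poly_def[abs_def] tensor_poly_dz_def[abs_def] fst_conv snd_conv
  by (intro conjI ballI allI refl continuous_intros DERIV_sum DERIV_cmult_right DERIV_cmult)
     (auto intro!: derivative_eq_intros)

text \<open>Differentiation lowers the degree in z from kz + 1 to kz; this is why the penalty bound
  involves \<open>C_dt kz\<close>.\<close>

lemma tensor_poly_dz_slice:
  "\<exists>p. degree p \<le> m \<and> (\<forall>z. tensor_poly_dz (m + 1) n c (z, \<mu>) = poly p z)"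
proof (intro exI conjI allI)
  let ?p = "\<Sum>i\<le>m + 1. monom (\<Sum>j\<le>n. c i j * real i * \<mu> ^ j) (i - 1)"
  show "degree ?p \<le> m"
    by (intro degree_sum_le) (auto intro: order.trans[OF degree_monom_le])
  show "tensor_poly_dz (m + 1) n c (z, \<mu>) = poly ?p z" for z
    unfolding tensor_poly_dz_def poly_sum poly_monom sum_distrib_right fst_conv snd_conv
    by (intro sum.cong refl) (simp add: mult_ac)
qed

lemma Vh_basis_comb:
  "(\<Sum>\<iota>\<in>T \<times> {..m} \<times> {..n}. d \<iota> * Vh_basis \<iota> p) = pw T (\<lambda>K. tensor_poly m n (\<lambda>i j. d (K, i, j))) p"
  unfolding pw_def tensor_poly_def Vh_basis_def sum_distrib_left sum.cartesian_product'
  by (intro sum.cong refl) (simp add: mult_ac)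

text \<open>Equality of genuine functions is possible because \<open>Vh\<close> prescribes the value
  0 off the open elements, just as the indicators in \<open>Vh_basis\<close> do.\<close>

lemma (in dg_mesh) Vh_eq_lincombs: "Vh T kz kmu = lincombs Vh_basis (T \<times> {..kz + 1} \<times> {..kmu})"
proof (intro equalityI subsetI)
  fix v assume "v \<in> Vh T kz kmu"
  then have "\<forall>K\<in>T. \<exists>c. \<forall>z \<mu>. (z, \<mu>) \<in> rect_set K \<longrightarrow> v (z, \<mu>) = (\<Sum>i\<le>kz+1. \<Sum>j\<le>kmu. c i j * z^i * \<mu>^j)"
    and zero: "\<And>x. x \<notin> (\<Union>K\<in>T. rect_set K) \<Longrightarrow> v x = 0"
    unfolding Vh_def by blast+
  from bchoice[OF this(1)] obtain c where c: "\<And>K z \<mu>. K \<in> T \<Longrightarrow> (z, \<mu>) \<in> rect_set K \<Longrightarrow>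
      v (z, \<mu>) = (\<Sum>i\<le>kz+1. \<Sum>j\<le>kmu. c K i j * z^i * \<mu>^j)" by blast
  have "v p = pw T (\<lambda>K. tensor_poly (kz + 1) kmu (c K)) p" for p
  proof (cases "\<exists>K\<in>T. p \<in> rect_set K")
    case True
    then obtain K where K: "K \<in> T" "p \<in> rect_set K" by blast
    show ?thesis using c[OF K(1), of "fst p" "snd p"] K(2) pw_eq[OF K] by (simp add: tensor_poly_def)
  next
    case False
    then show ?thesis using zero pw_zero by auto
  qed
  then have "v = (\<lambda>p. \<Sum>\<iota>\<in>T \<times> {..kz + 1} \<times> {..kmu}. (\<lambda>(K, i, j). c K i j) \<iota> * Vh_basis \<iota> p)"
    unfolding Vh_basis_comb by auto
  then show "v \<in> lincombs Vh_basis (T \<times> {..kz + 1} \<times> {..kmu})" unfolding lincombs_def by blast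
next
  fix v assume "v \<in> lincombs Vh_basis (T \<times> {..kz + 1} \<times> {..kmu})"
  then obtain d where "v = (\<lambda>p. \<Sum>\<iota>\<in>T \<times> {..kz + 1} \<times> {..kmu}. d \<iota> * Vh_basis \<iota> p)"
    unfolding lincombs_def by blast
  then have v: "v = pw T (\<lambda>K. tensor_poly (kz + 1) kmu (\<lambda>i j. d (K, i, j)))" unfolding Vh_basis_comb by simp
  show "v \<in> Vh T kz kmu"
    unfolding Vh_def
  proof (intro CollectI conjI ballI allI impI)
    fix K assume K: "K \<in> T"
    show "\<exists>c. \<forall>z \<mu>. (z, \<mu>) \<in> rect_set K \<longrightarrow> v (z, \<mu>) = (\<Sum>i\<le>kz+1. \<Sum>j\<le>kmu. c i j * z^i * \<mu>^j)"
      by (intro exI[of _ "\<lambda>i j. d (K, i, j)"] allI impI) (simp add: v pw_eq[OF K] tensor_poly_def)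
  next
    fix x assume "x \<notin> (\<Union>K\<in>T. rect_set K)"
    then show "v x = 0" unfolding v by (intro pw_zero) blast
  qed
qed

lemma (in dg_mesh) Vh_representation:
  assumes "v \<in> Vh T kz kmu"
  obtains w w' where "represents T v w w'"
    "\<forall>K\<in>T. \<forall>\<mu>. \<exists>p. degree p \<le> kz \<and> (\<forall>z. w' K (z, \<mu>) = poly p z)"
proof -
  obtain d where "v = (\<lambda>p. \<Sum>\<iota>\<in>T \<times> {..kz + 1} \<times> {..kmu}. d \<iota> * Vh_basis \<iota> p)"
    using assms unfolding Vh_eq_lincombs lincombs_def by blast
  then have v: "v = pw T (\<lambda>K. tensor_poly (kz + 1) kmu (\<lambda>i j. d (K, i, j)))" unfolding Vh_basis_comb by simp
  show thesis
    by (rule that[OF represents_tensor_poly[of T "kz + 1" kmu "\<lambda>K i j. d (K, i, j)", folded v]])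
       (intro ballI allI tensor_poly_dz_slice)
qed

text \<open>On a finite measure space |f| \<le> 1 + f^2 makes the product with a bounded function
  integrable. The weight is 1 for the volume load and \<mu> for the boundary load, where only the
  weighted square of g is integrable.\<close>

lemma integrable_weighted_mult_bounded:
  fixes f v \<omega> :: "'a \<Rightarrow> real"
  assumes "finite_measure M" "f \<in> borel_measurable M" "v \<in> borel_measurable M" "\<omega> \<in> borel_measurable M"
    and \<omega>: "\<And>x. x \<in> space M \<Longrightarrow> 0 \<le> \<omega> x \<and> \<omega> x \<le> 1"
    and int: "integrable M (\<lambda>x. (f x)\<^sup>2 * \<omega> x)" and v: "\<And>x. \<bar>v x\<bar> \<le> B"
  shows "integrable M (\<lambda>x. f x * v x * \<omega> x)"
proof (rule Bochner_Integration.integrable_bound)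
  interpret finite_measure M by fact
  show "integrable M (\<lambda>x. B * (1 + (f x)\<^sup>2 * \<omega> x))"
    using int by (intro integrable_mult_right Bochner_Integration.integrable_add) auto
  show "(\<lambda>x. f x * v x * \<omega> x) \<in> borel_measurable M" using assms by measurable
  show "AE x in M. norm (f x * v x * \<omega> x) \<le> norm (B * (1 + (f x)\<^sup>2 * \<omega> x))"
  proof (rule AE_I2)
    fix x assume x: "x \<in> space M"
    have B: "B \<ge> 0" using v[of x] by linarith
    \<comment> \<open>Nonnegativity of (|f| - 1/2)^2 even gives |f| \<le> 1/4 + f^2.\<close>
    have "\<bar>f x\<bar> \<le> 1 + (f x)\<^sup>2" using sum_power2_ge_zero[of "\<bar>f x\<bar> - 1/2" 0] by (simp add: power2_eq_square algebra_simps)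
    then have "\<bar>f x\<bar> * \<omega> x \<le> (1 + (f x)\<^sup>2) * \<omega> x" using \<omega>[OF x] by (intro mult_right_mono) auto
    also have "\<dots> \<le> 1 + (f x)\<^sup>2 * \<omega> x" using \<omega>[OF x] by (simp add: algebra_simps)
    finally have "\<bar>v x\<bar> * (\<bar>f x\<bar> * \<omega> x) \<le> B * (1 + (f x)\<^sup>2 * \<omega> x)" using v[of x] \<omega>[OF x] B by (intro mult_mono) auto
    then show "norm (f x * v x * \<omega> x) \<le> norm (B * (1 + (f x)\<^sup>2 * \<omega> x))"
      using \<omega>[OF x] B by (simp add: abs_mult mult_ac)
  qed
qed

section \<open>Integrability and linearity of the load\<close>

context dg_mesh
begin

lemma load_integrable:
  assumes "L2 (Omega L) f" "represents T v w w'"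
  shows "integrable (lebesgue_on (Omega L)) (\<lambda>p. f p * v p)"
proof -
  have fm: "finite_measure (lebesgue_on (Omega L))"
    using open_Omega bounded_Omega by (intro finite_measure_lebesgue_on bounded_set_imp_lmeasurable) auto
  have b: "bdd_borel v" using assms(2) by (rule represents_bdd_borel)
  have "v \<in> borel_measurable (lebesgue_on (Omega L))" by (intro measurable_lebesgue_on_borel bdd_borel_measurable b)
  moreover obtain B where "\<And>x. \<bar>v x\<bar> \<le> B" using b by (auto simp: bdd_borel_def)
  ultimately have "integrable (lebesgue_on (Omega L)) (\<lambda>p. f p * v p * 1)"
    using assms(1) by (intro integrable_weighted_mult_bounded[OF fm]) (auto simp: L2_def)
  then show ?thesis by simp
qed

lemma boundary_load_integrable:
  assumes g: "L2_Gamma L g" and v: "represents T v w w'"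
  shows "integrable (lebesgue_on {0<..<1})
    (\<lambda>\<mu>. (g (L, \<mu>) * trace_h L v (L, \<mu>) + g (0, \<mu>) * trace_h L v (0, \<mu>)) * \<mu>)"
proof -
  let ?M = "lebesgue_on {0<..<1::real}"
  have fm: "finite_measure ?M" by (intro finite_measure_lebesgue_on bounded_set_imp_lmeasurable) auto
  have cw: "\<forall>K\<in>T. continuous_on UNIV (w K)" using v by (simp add: represents_def)
  have gm: "(\<lambda>\<mu>. g (L,\<mu>)) \<in> borel_measurable ?M" "(\<lambda>\<mu>. g (0,\<mu>)) \<in> borel_measurable ?M"
    and gi: "integrable ?M (\<lambda>\<mu>. ((g (L,\<mu>))\<^sup>2 + (g (0,\<mu>))\<^sup>2) * \<mu>)" using g by (auto simp: L2_Gamma_def)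
  have id: "(\<lambda>\<mu>. \<mu>) \<in> borel_measurable ?M" by (rule measurable_lebesgue_on_borel) simp
  have part: "integrable ?M (\<lambda>\<mu>. g (z, \<mu>) * t \<mu> * \<mu>)" if z: "z = L \<or> z = 0" and t: "bdd_borel t" for z t
  proof -
    have gz: "(\<lambda>\<mu>. g (z,\<mu>)) \<in> borel_measurable ?M" using z gm by auto
    \<comment> \<open>\<open>L2_Gamma\<close> controls only the sum of the two squared boundary
      values; each one is dominated by that sum since \<mu> is nonnegative.\<close>
    have "integrable ?M (\<lambda>\<mu>. (g (z,\<mu>))\<^sup>2 * \<mu>)"
    proof (rule Bochner_Integration.integrable_bound[OF gi])
      show "(\<lambda>\<mu>. (g (z,\<mu>))\<^sup>2 * \<mu>) \<in> borel_measurable ?M" using gz id by measurable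
      show "AE \<mu> in ?M. norm ((g (z,\<mu>))\<^sup>2 * \<mu>) \<le> norm (((g (L,\<mu>))\<^sup>2 + (g (0,\<mu>))\<^sup>2) * \<mu>)"
        using z by (intro AE_I2) (auto simp: space_restrict_space abs_mult intro!: mult_right_mono)
    qed
    moreover have "t \<in> borel_measurable ?M" by (intro measurable_lebesgue_on_borel bdd_borel_measurable t)
    moreover obtain B where "\<And>x. \<bar>t x\<bar> \<le> B" using t by (auto simp: bdd_borel_def)
    ultimately show ?thesis
      using gz by (intro integrable_weighted_mult_bounded[OF fm] id) (auto simp: space_restrict_space)
  qed
  have "integrable ?M (\<lambda>\<mu>. g (L, \<mu>) * left_trace T w L \<mu> * \<mu> + g (0, \<mu>) * right_trace T w 0 \<mu> * \<mu>)"
    by (intro Bochner_Integration.integrable_add part bdd_borel_left_trace bdd_borel_right_trace cw) auto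
  then show ?thesis by (simp add: trace_h_eq[OF v] distrib_right)
qed

lemma load_lin:
  assumes f: "L2 (Omega L) f" and g: "L2_Gamma L g" and u: "represents T u w w'" and v: "represents T v x x'"
  shows "ip L f (\<lambda>p. u p + s * v p) + bip L g (trace_h L (\<lambda>p. u p + s * v p)) =
     (ip L f u + bip L g (trace_h L u)) + s * (ip L f v + bip L g (trace_h L v))"
proof -
  have "ip L f (\<lambda>p. u p + s * v p) = ip L f u + s * ip L f v"
    unfolding ip_def
    by (intro integral_lin load_integrable[OF f u] load_integrable[OF f v]) (simp add: algebra_simps)
  moreover have "bip L g (trace_h L (\<lambda>p. u p + s * v p)) = bip L g (trace_h L u) + s * bip L g (trace_h L v)"
    unfolding bip_def
    by (intro integral_lin boundary_load_integrable[OF g u] boundary_load_integrable[OF g v])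
       (simp add: trace_h_eq[OF represents_lin[OF u v]] trace_h_eq[OF u] trace_h_eq[OF v]
          left_trace_lin right_trace_lin algebra_simps)
  ultimately show ?thesis by (simp add: algebra_simps)
qed

end

section \<open>Existence and uniqueness of the discrete solution\<close>

theorem mainTheorem5:
  fixes L c :: real and \<sigma>s \<sigma>t :: "real \<Rightarrow> real" and T :: "rect set"
    and kz kmu :: nat and \<alpha> :: "rect \<times> rect \<Rightarrow> real"
    and f g :: "real \<times> real \<Rightarrow> real"
  assumes L_pos: "L > 0"
    and \<sigma>s_meas: "\<sigma>s \<in> borel_measurable (lebesgue_on {0<..<L})"
    and \<sigma>t_meas: "\<sigma>t \<in> borel_measurable (lebesgue_on {0<..<L})"
    and \<sigma>s_bdd: "\<exists>B. AE z in lebesgue_on {0<..<L}. \<bar>\<sigma>s z\<bar> \<le> B"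
    and \<sigma>t_bdd: "\<exists>B. AE z in lebesgue_on {0<..<L}. \<bar>\<sigma>t z\<bar> \<le> B"
    and \<sigma>s_nonneg: "AE z in lebesgue_on {0<..<L}. \<sigma>s z \<ge> 0"
    and c_pos: "c > 0"
    and absorb: "AE z in lebesgue_on {0<..<L}. \<sigma>t z - \<sigma>s z \<ge> c"
    and mesh: "is_mesh L T"
    and \<sigma>t_const: "\<forall>K\<in>T. \<exists>s. \<forall>z\<in>{zl K<..<zr K}. \<sigma>t z = s"
    and \<alpha>_pos: "\<forall>F\<in>vfaces T. \<alpha> F > 0"
    and \<alpha>_large: "\<forall>F\<in>vfaces T. \<alpha> F \<ge> 1/2 + C_dt kz"
    and f_L2: "L2 (Omega L) f"
    and g_L2: "L2_Gamma L g"
  shows "\<exists>!uh. uh \<in> Vh T kz kmu \<and>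
           (\<forall>vh\<in>Vh T kz kmu. a_h L \<sigma>s \<sigma>t T \<alpha> uh vh = ip L f vh + bip L g (trace_h L vh))"
proof -
  obtain B where B: "AE z in lebesgue_on {0<..<L}. \<bar>\<sigma>s z\<bar> \<le> B" using \<sigma>s_bdd by blast
  obtain \<rho> where \<rho>: "bdd_borel \<rho>" "\<And>z. \<rho> z \<ge> 0" "AE z in lebesgue_on {0<..<L}. \<sigma>s z = \<rho> z"
    using bdd_borel_representative[OF \<sigma>s_meas _ \<sigma>s_nonneg B] by auto
  have ab: "AE z in lebesgue_on {0<..<L}. \<sigma>t z - \<rho> z \<ge> c"
    using absorb \<rho>(3) by eventually_elim simp
  interpret dg_problem L \<sigma>t T \<sigma>s \<rho> c \<alpha>
    by unfold_locales (fact L_pos mesh \<sigma>t_const \<rho> c_pos ab)+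
  let ?V = "Vh T kz kmu" and ?a = "a_h L \<sigma>s \<sigma>t T \<alpha>"
  let ?I = "T \<times> {..kz + 1} \<times> {..kmu}" and ?l = "\<lambda>v. ip L f v + bip L g (trace_h L v)"
  have \<alpha>2: "\<forall>F\<in>vfaces T. \<alpha> F \<ge> C_dt kz / 2"
  proof
    fix F assume "F \<in> vfaces T"
    then have "\<alpha> F \<ge> 1/2 + C_dt kz" using \<alpha>_large by blast
    then show "\<alpha> F \<ge> C_dt kz / 2" using C_dt_ge_1[of kz] by linarith
  qed
  have lin1: "?a (\<lambda>x. u x + s * v x) y = ?a u y + s * ?a v y" if "u \<in> ?V" "v \<in> ?V" "y \<in> ?V" for u v y s
    using that by (elim Vh_representation) (rule a_h_lin)
  have V_lin: "(\<lambda>x. u x + s * v x) \<in> ?V" if "u \<in> ?V" "v \<in> ?V" for u v s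
    using that unfolding Vh_eq_lincombs by (rule lincombs_lin)
  have comm: "?a u v = ?a v u" if "u \<in> ?V" "v \<in> ?V" for u v
    using that by (elim Vh_representation) (rule a_h_commute)
  have definite: "u = (\<lambda>x. 0)" if uV: "u \<in> ?V" and au: "?a u u = 0" for u
  proof -
    obtain w w' where "represents T u w w'" "\<forall>K\<in>T. \<forall>\<mu>. \<exists>p. degree p \<le> kz \<and> (\<forall>z. w' K (z, \<mu>) = poly p z)"
      using Vh_representation[OF uV] by blast
    then show ?thesis using \<alpha>2 au by (rule a_h_definite)
  qed
  have lin2: "?a y (\<lambda>x. u x + s * v x) = ?a y u + s * ?a y v" if "u \<in> ?V" "v \<in> ?V" "y \<in> ?V" for u v y s
    using lin1[OF that] comm[OF that(3) V_lin[OF that(1,2)]] comm[OF that(3,1)] comm[OF that(3,2)] by simp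
  have l_lin: "?l (\<lambda>x. u x + s * v x) = ?l u + s * ?l v" if "u \<in> ?V" "v \<in> ?V" for u v s
    using that by (elim Vh_representation) (rule load_lin[OF f_L2 g_L2])
  have "finite ?I" using finite_T by simp
  then have "\<exists>u\<in>lincombs Vh_basis ?I. \<forall>v\<in>lincombs Vh_basis ?I. ?a u v = ?l v"
    using lin1 lin2 l_lin definite unfolding Vh_eq_lincombs by (rule definite_form_solvable)
  then obtain u where u: "u \<in> ?V" "\<forall>v\<in>?V. ?a u v = ?l v" unfolding Vh_eq_lincombs by blast
  show ?thesis
  proof (rule ex1I[of _ u])
    show "u \<in> ?V \<and> (\<forall>v\<in>?V. ?a u v = ?l v)" using u by blast
    fix u' assume u': "u' \<in> ?V \<and> (\<forall>v\<in>?V. ?a u' v = ?l v)"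
    \<comment> \<open>The difference is written with the factor -1 to fit the combined linearity
      rules. Both solutions have the same load on this test function, so the form vanishes on
      it.\<close>
    let ?d = "\<lambda>x. u' x + (-1) * u x"
    have d: "?d \<in> ?V" using u u' by (intro V_lin) auto
    have "?a ?d ?d = ?a u' ?d + (-1) * ?a u ?d" using u u' d by (intro lin1) auto
    then have "?a ?d ?d = 0" using u u' d by simp
    then have "?d = (\<lambda>x. 0)" by (rule definite[OF d])
    then show "u' = u" by (auto simp: fun_eq_iff)
  qed
qed

end
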